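(* Let $R$ be a ring. (1) Assume that $\preccurlyeq\,\in\mathscr{L}^1_R$ is pleasant. If $\lambda$ is an infinite cardinal with $\lambda^{\operatorname{card}(R)+\aleph_0}=\lambda$, then $(R\text{-}\mathrm{Mod},\preccurlyeq)$ is $\lambda$-stable. (2) Assume that $\preccurlyeq\,\in\mathscr{L}^2_R$ is E-nice. Then $(R\text{-}\mathrm{Mod},\preccurlyeq)$ is stable.
   Context: Rings are associative with identity, modules are left modules, $\operatorname{card}(R)$ is the cardinality of $R$. $R\text{-}\mathrm{Mod}$ is the class of all $R$-modules, viewed as structures in the language $\tau_R=\{0,+,-\}\cup\{r\cdot\mid r\in R\}$. $A\leq B$ means submodule, $A\leq_\oplus B$ means direct summand. AEC: a pair $\mathcal K=(\mathbf K,\preccurlyeq)$, with $\mathbf K$ a class of $L$-structures and $\preccurlyeq$ a binary relation on $\mathbf K$, such that: (i) $\mathbf K$ and $\preccurlyeq$ are closed under isomorphisms; (ii) $A\preccurlyeq B$ implies $A$ is a substructure of $B$; (iii) $\preccurlyeq$ is a partial order; (iv) if $(A_i)_{i<\delta}$ ($\delta$ limit) is an increasing continuous $\preccurlyeq$-chain in $\mathbf K$, then $A=\bigcup_{i<\delta}A_i\in\mathbf K$, $A_j\preccurlyeq A$ for all $j<\delta$, and if $A_i\preccurlyeq B$ for all $i<\delta$ then $A\preccurlyeq B$; (v) if $A\preccurlyeq C$, $B\preccurlyeq C$ and $A$ is a substructure of $B$ then $A\preccurlyeq B$; (vi) there is a cardinal $\lambda\geq|L|+\aleph_0$ such that for all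 $B\in\mathbf K$, $X\subseteq B$ there is $A\in\mathbf K$ with $X\subseteq A\preccurlyeq B$ and $|A|\leq|X|+\lambda$; the least such $\lambda$ is $\mathrm{LS}(\mathcal K)$. An embedding $f:A\to B$ is strong if $f(A)\preccurlyeq B$. $\mathscr{L}_R$ is the class of all binary relations $\preccurlyeq$ on $R\text{-}\mathrm{Mod}$ such that $(R\text{-}\mathrm{Mod},\preccurlyeq)$ is an AEC and $A\leq_\oplus B$ implies $A\preccurlyeq B$, ordered by reverse inclusion. Purity: $A\leq_{\mathrm{pp}}B$ iff $A\leq B$ and every finite system of $R$-linear equations with right-hand side in $A$ solvable in $B$ is solvable in $A$. $\mathscr{L}^1_R=\{\preccurlyeq\,\in\mathscr L_R\mid\ \leq_{\mathrm{pp}}\subseteq\preccurlyeq\}$ (below purity) and $\mathscr{L}^2_R=\{\preccurlyeq\,\in\mathscr L_R\mid\ \preccurlyeq\,\subseteq\,\leq_{\mathrm{pp}}\}$ (above purity). For a set $\Sigma$ of formulas in $\tau_R$, $A\leq_\Sigma B$ iff $A\leq B$ and for all $\varphi(\bar x)\in\Sigma$, $\bar a\in A^{|\bar x|}$: $A\models\varphi(\bar a)\Leftrightarrow B\models\varphi(\bar a)$. Pleasant: a set $\Sigma$ of formulas is pleasant if every member has the form $\exists\bar y\,(H\bar y=K\bar x)$ with $H\in\operatorname{Mat}_{m\times n}(R)$, $K\in\operatorname{Mat}_{m\times s}(R)$, $\bar y=(y_1,\dots,y_n)$, $\bar x=(x_1,\dots,x_s)$, and whenever $\exists\bar y\,(H\bar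 y=K\bar x)\in\Sigma$ then also $\exists\bar y\,(H\bar y=\bar z)\in\Sigma$ with $\bar z=(z_1,\dots,z_m)$. A relation $\preccurlyeq$ is pleasant if $\preccurlyeq\,=\,\leq_\Sigma$ for some pleasant $\Sigma$. E-nice: a relation $\preccurlyeq$ is E-nice if $\preccurlyeq\,=\,\leq_\Sigma$ for some infinite cardinal $\lambda\geq\operatorname{card}(R)$ and some set $\Sigma$ of formulas each of the form $\exists(v_\ell)_{\ell<\lambda}\bigwedge_{i<\lambda}\big(\sum_{\ell<\lambda}r_{i,\ell}v_\ell+\sum_{j<n}q_{i,j}x_j=0\big)$ with $n<\omega$, $r_{i,\ell},q_{i,j}\in R$, and for each $i$ only finitely many $r_{i,\ell}$ nonzero. Types and stability: for $\ell\in\{1,2\}$, $A_\ell\in\mathbf K$, $X_\ell\subseteq A_\ell$, $\bar b_\ell$ a sequence from $A_\ell$, put $(\bar b_1,X_1,A_1)\,E^{\mathrm{at}}_{\mathcal K}\,(\bar b_2,X_2,A_2)$ iff $X_1=X_2=:X$ and there are $A_*\in\mathbf K$ and strong embeddings $f_\ell:A_\ell\to A_*$ with $f_1\restriction X=f_2\restriction X=\mathrm{id}_X$ and $f_1(\bar b_1)=f_2(\bar b_2)$. $E_{\mathcal K}$ is the transitive closure, and $\mathbf{gtp}_{\mathcal K}(\bar b/X;A)$ is the $E_{\mathcal K}$-class of $(\bar b,X,A)$. $\mathcal S_{\mathcal K}(A)=\{\mathbf{gtp}_{\mathcal K}(b/A;B)\mid A\preccurlyeq B\in\mathbf K,\ b\in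 B\}$. For $\lambda\geq\mathrm{LS}(\mathcal K)$, $\mathcal K$ is $\lambda$-stable if $|\mathcal S_{\mathcal K}(A)|\leq\lambda$ for every $A\in\mathbf K$ with $|A|=\lambda$. $\mathcal K$ is stable if it is $\mu$-stable for unboundedly many cardinals $\mu$. *)

theory Defs
  imports
    "HOL-Algebra.Module"
    "Jordan_Normal_Form.Matrix"
begin

unbundle cardinal_syntax

section \<open>The set-theoretic universe\<close>

text \<open>
  A proper class of sets is not available in HOL, so the universe of sets is a type \<open>'u\<close> whose
  cardinality is a strongly inaccessible cardinal. The subsets of \<open>'u\<close> of cardinality smaller than
  \<open>'u\<close> play the role of sets (up to bijection), and the cardinals (ordinals) of the universe are the
  cardinals (ordinals) below the cardinality of \<open>'u\<close>.
\<close>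

definition inaccessible :: "'a rel \<Rightarrow> bool" where
  "inaccessible r \<longleftrightarrow>
     Card_order r \<and> natLeq <o r \<and> regularCard r \<and>
     (\<forall>s::'a rel. Card_order s \<and> s <o r \<longrightarrow> ctwo ^c s <o r)"

definition small_cardinal :: "'u rel \<Rightarrow> bool" where
  "small_cardinal l \<longleftrightarrow> Card_order l \<and> l <o |UNIV :: 'u set|"


section \<open>Left modules\<close>

text \<open>The library locale \<open>module\<close> requires a commutative ring of scalars.\<close>

definition left_module :: "('r, 'm) ring_scheme \<Rightarrow> ('r, 'u, 'n) module_scheme \<Rightarrow> bool" where
  "left_module R M \<longleftrightarrow>
     ring R \<and> abelian_group M \<and>
     (\<forall>r\<in>carrier R. \<forall>x\<in>carrier M. r \<odot>\<^bsub>M\<^esub> x \<in> carrier M) \<and>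
     (\<forall>r\<in>carrier R. \<forall>s\<in>carrier R. \<forall>x\<in>carrier M.
        (r \<oplus>\<^bsub>R\<^esub> s) \<odot>\<^bsub>M\<^esub> x = r \<odot>\<^bsub>M\<^esub> x \<oplus>\<^bsub>M\<^esub> s \<odot>\<^bsub>M\<^esub> x) \<and>
     (\<forall>r\<in>carrier R. \<forall>x\<in>carrier M. \<forall>y\<in>carrier M.
        r \<odot>\<^bsub>M\<^esub> (x \<oplus>\<^bsub>M\<^esub> y) = r \<odot>\<^bsub>M\<^esub> x \<oplus>\<^bsub>M\<^esub> r \<odot>\<^bsub>M\<^esub> y) \<and>
     (\<forall>r\<in>carrier R. \<forall>s\<in>carrier R. \<forall>x\<in>carrier M.
        (r \<otimes>\<^bsub>R\<^esub> s) \<odot>\<^bsub>M\<^esub> x = r \<odot>\<^bsub>M\<^esub> (s \<odot>\<^bsub>M\<^esub> x)) \<and>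
     (\<forall>x\<in>carrier M. \<one>\<^bsub>R\<^esub> \<odot>\<^bsub>M\<^esub> x = x)"

text \<open>
  The structure that \<open>M\<close> induces on \<open>S\<close>. Operations are \<open>undefined\<close> outside \<open>S\<close> (and outside
  \<open>carrier R\<close> for scalars), and so are the fields \<open>mult\<close> and \<open>one\<close>, which the record type inherits
  from rings but which have no meaning for modules.
\<close>

definition restrict_module ::
    "('r, 'm) ring_scheme \<Rightarrow> ('r, 'u) module \<Rightarrow> 'u set \<Rightarrow> ('r, 'u) module" where
  "restrict_module R M S =
     \<lparr>carrier = S, mult = undefined, one = undefined, zero = \<zero>\<^bsub>M\<^esub>,
      add = (\<lambda>x y. if x \<in> S \<and> y \<in> S then x \<oplus>\<^bsub>M\<^esub> y else undefined),
      smult = (\<lambda>r x. if r \<in> carrier R \<and> x \<in> S then r \<odot>\<^bsub>M\<^esub> x else undefined)\<rparr>"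

text \<open>
  The equation in the definition of \<open>RMod\<close> removes junk values, so that equality of records is
  equality of structures on the carrier. Negation is determined by the other operations.
\<close>

definition RMod :: "('r, 'm) ring_scheme \<Rightarrow> ('r, 'u) module set" where
  "RMod R = {M. left_module R M \<and> M = restrict_module R M (carrier M) \<and>
                |carrier M| <o |UNIV :: 'u set| }"

definition substructure ::
    "('r, 'm) ring_scheme \<Rightarrow> ('r, 'u) module \<Rightarrow> ('r, 'u) module \<Rightarrow> bool" where
  "substructure R A B \<longleftrightarrow> carrier A \<subseteq> carrier B \<and> A = restrict_module R B (carrier A)"

definition direct_summand ::
    "('r, 'm) ring_scheme \<Rightarrow> ('r, 'u) module \<Rightarrow> ('r, 'u) module \<Rightarrow> bool" where
  "direct_summand R A B \<longleftrightarrow>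
     A \<in> RMod R \<and> B \<in> RMod R \<and> substructure R A B \<and>
     (\<exists>C\<in>RMod R. substructure R C B \<and> carrier A \<inter> carrier C = {\<zero>\<^bsub>B\<^esub>} \<and>
        carrier B = {a \<oplus>\<^bsub>B\<^esub> c | a c. a \<in> carrier A \<and> c \<in> carrier C})"

definition mod_hom ::
    "('r, 'm) ring_scheme \<Rightarrow> ('r, 'u) module \<Rightarrow> ('r, 'u) module \<Rightarrow> ('u \<Rightarrow> 'u) set" where
  "mod_hom R A B =
     {f \<in> carrier A \<rightarrow> carrier B.
        (\<forall>x\<in>carrier A. \<forall>y\<in>carrier A. f (x \<oplus>\<^bsub>A\<^esub> y) = f x \<oplus>\<^bsub>B\<^esub> f y) \<and>
        (\<forall>r\<in>carrier R. \<forall>x\<in>carrier A. f (r \<odot>\<^bsub>A\<^esub> x) = r \<odot>\<^bsub>B\<^esub> f x)}"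

definition mod_iso ::
    "('r, 'm) ring_scheme \<Rightarrow> ('r, 'u) module \<Rightarrow> ('r, 'u) module \<Rightarrow> ('u \<Rightarrow> 'u) set" where
  "mod_iso R A B = {f \<in> mod_hom R A B. bij_betw f (carrier A) (carrier B)}"


section \<open>Abstract elementary classes of modules\<close>

text \<open>For normalised \<open>A\<close> these conditions determine \<open>A\<close> when the family is a nonempty chain.\<close>

definition is_union ::
    "('r, 'm) ring_scheme \<Rightarrow> ('r, 'u) module \<Rightarrow> 'i set \<Rightarrow> ('i \<Rightarrow> ('r, 'u) module) \<Rightarrow> bool" where
  "is_union R A I C \<longleftrightarrow>
     carrier A = (\<Union>i\<in>I. carrier (C i)) \<and> (\<forall>i\<in>I. substructure R (C i) A)"

text \<open>
  An ordinal is given by a well-order \<open>d\<close>, its elements being the points of \<open>Field d\<close>; the predicate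
  below says that an initial segment \<open>I\<close> of \<open>d\<close> represents a nonzero limit ordinal.
\<close>

definition limit_segment :: "'i rel \<Rightarrow> 'i set \<Rightarrow> bool" where
  "limit_segment d I \<longleftrightarrow> I \<noteq> {} \<and> (\<forall>i\<in>I. \<exists>j\<in>I. i \<in> underS d j)"

definition continuous_chain ::
    "('r, 'm) ring_scheme \<Rightarrow> ('r, 'u) module set \<Rightarrow> ('r, 'u) module rel \<Rightarrow>
     'i rel \<Rightarrow> ('i \<Rightarrow> ('r, 'u) module) \<Rightarrow> bool" where
  "continuous_chain R K prec d C \<longleftrightarrow>
     (\<forall>i\<in>Field d. C i \<in> K) \<and>
     (\<forall>i j. (i, j) \<in> d \<longrightarrow> (C i, C j) \<in> prec) \<and>
     (\<forall>i\<in>Field d. limit_segment d (underS d i) \<longrightarrow> is_union R (C i) (underS d i) C)"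

text \<open>
  The vocabulary has the symbols \<open>0\<close>, \<open>+\<close>, \<open>-\<close> and one function symbol for each scalar, so its
  cardinality plus \<open>\<aleph>\<^sub>0\<close> is \<open>|carrier R| +c natLeq\<close>.
\<close>

definition LS_bound ::
    "('r, 'm) ring_scheme \<Rightarrow> ('r, 'u) module set \<Rightarrow> ('r, 'u) module rel \<Rightarrow> 'u rel \<Rightarrow> bool" where
  "LS_bound R K prec l \<longleftrightarrow>
     small_cardinal l \<and> |carrier R| +c natLeq \<le>o l \<and>
     (\<forall>B\<in>K. \<forall>X. X \<subseteq> carrier B \<longrightarrow>
        (\<exists>A\<in>K. X \<subseteq> carrier A \<and> (A, B) \<in> prec \<and> |carrier A| \<le>o |X| +c l))"

definition LS_number ::
    "('r, 'm) ring_scheme \<Rightarrow> ('r, 'u) module set \<Rightarrow> ('r, 'u) module rel \<Rightarrow> 'u rel \<Rightarrow> bool" where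
  "LS_number R K prec l \<longleftrightarrow> LS_bound R K prec l \<and> (\<forall>l'. LS_bound R K prec l' \<longrightarrow> l \<le>o l')"

definition AEC ::
    "('r, 'm) ring_scheme \<Rightarrow> ('r, 'u) module set \<Rightarrow> ('r, 'u) module rel \<Rightarrow> bool" where
  "AEC R K prec \<longleftrightarrow>
     K \<subseteq> RMod R \<and>
     (\<forall>A\<in>K. \<forall>B\<in>RMod R. mod_iso R A B \<noteq> {} \<longrightarrow> B \<in> K) \<and>
     (\<forall>A B A' B' f. (A, B) \<in> prec \<and> A' \<in> RMod R \<and> B' \<in> RMod R \<and>
        f \<in> mod_iso R B B' \<and> f \<in> mod_iso R A A' \<longrightarrow> (A', B') \<in> prec) \<and>
     (\<forall>A B. (A, B) \<in> prec \<longrightarrow> substructure R A B) \<and>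
     partial_order_on K prec \<and>
     (\<forall>(d :: 'u rel) C.
        Well_order d \<and> d <o |UNIV :: 'u set| \<and> limit_segment d (Field d) \<and>
        continuous_chain R K prec d C \<longrightarrow>
        (\<exists>A\<in>K. is_union R A (Field d) C \<and> (\<forall>j\<in>Field d. (C j, A) \<in> prec) \<and>
           (\<forall>B\<in>K. (\<forall>i\<in>Field d. (C i, B) \<in> prec) \<longrightarrow> (A, B) \<in> prec))) \<and>
     (\<forall>A B C. (A, C) \<in> prec \<and> (B, C) \<in> prec \<and> substructure R A B \<longrightarrow> (A, B) \<in> prec) \<and>
     (\<exists>l. LS_bound R K prec l)"


section \<open>The relations below and above purity\<close>

definition lincomb ::
    "('r, 'u) module \<Rightarrow> 'r mat \<Rightarrow> nat \<Rightarrow> (nat \<Rightarrow> 'u) \<Rightarrow> 'u" where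
  "lincomb M H i y = (\<Oplus>\<^bsub>M\<^esub>j\<in>{..<dim_col H}. H $$ (i, j) \<odot>\<^bsub>M\<^esub> y j)"

definition pure_le :: "('r, 'm) ring_scheme \<Rightarrow> ('r, 'u) module rel" where
  "pure_le R =
     {(A, B). A \<in> RMod R \<and> B \<in> RMod R \<and> substructure R A B \<and>
        (\<forall>H b. elements_mat H \<subseteq> carrier R \<and> b \<in> {..<dim_row H} \<rightarrow> carrier A \<and>
           (\<exists>y \<in> {..<dim_col H} \<rightarrow> carrier B. \<forall>i<dim_row H. lincomb B H i y = b i) \<longrightarrow>
           (\<exists>y \<in> {..<dim_col H} \<rightarrow> carrier A. \<forall>i<dim_row H. lincomb A H i y = b i))}"

definition LL :: "('r, 'm) ring_scheme \<Rightarrow> ('r, 'u) module rel set" where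
  "LL R = {prec. AEC R (RMod R) prec \<and> (\<forall>A B. direct_summand R A B \<longrightarrow> (A, B) \<in> prec)}"

definition LL1 :: "('r, 'm) ring_scheme \<Rightarrow> ('r, 'u) module rel set" where
  "LL1 R = {prec \<in> LL R. pure_le R \<subseteq> prec}"

definition LL2 :: "('r, 'm) ring_scheme \<Rightarrow> ('r, 'u) module rel set" where
  "LL2 R = {prec \<in> LL R. prec \<subseteq> pure_le R}"


section \<open>Relations given by sets of formulas\<close>

text \<open>
  Formulas are elements of a syntax type \<open>'f\<close>, where \<open>ar\<close> gives the number of free variables and
  \<open>sat\<close> the satisfaction relation.
\<close>

definition le_formulas ::
    "('r, 'm) ring_scheme \<Rightarrow> ('f \<Rightarrow> nat) \<Rightarrow> (('r, 'u) module \<Rightarrow> 'f \<Rightarrow> (nat \<Rightarrow> 'u) \<Rightarrow> bool) \<Rightarrow>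
     'f set \<Rightarrow> ('r, 'u) module rel" where
  "le_formulas R ar sat S =
     {(A, B). A \<in> RMod R \<and> B \<in> RMod R \<and> substructure R A B \<and>
        (\<forall>\<phi>\<in>S. \<forall>a \<in> {..<ar \<phi>} \<rightarrow> carrier A. sat A \<phi> a \<longleftrightarrow> sat B \<phi> a)}"

text \<open>The pair \<open>(H, K)\<close> is the formula \<open>\<exists>y. H y = K x\<close>.\<close>

type_synonym 'r pp_form = "'r mat \<times> 'r mat"

definition pp_arity :: "'r pp_form \<Rightarrow> nat" where
  "pp_arity \<phi> = dim_col (snd \<phi>)"

definition pp_sat :: "('r, 'u) module \<Rightarrow> 'r pp_form \<Rightarrow> (nat \<Rightarrow> 'u) \<Rightarrow> bool" where
  "pp_sat M \<phi> x \<longleftrightarrow>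
     (\<exists>y \<in> {..<dim_col (fst \<phi>)} \<rightarrow> carrier M.
        \<forall>i<dim_row (fst \<phi>). lincomb M (fst \<phi>) i y = lincomb M (snd \<phi>) i x)"

definition pleasant_set :: "('r, 'm) ring_scheme \<Rightarrow> 'r pp_form set \<Rightarrow> bool" where
  "pleasant_set R S \<longleftrightarrow>
     (\<forall>(H, K)\<in>S. dim_row H = dim_row K \<and>
        elements_mat H \<subseteq> carrier R \<and> elements_mat K \<subseteq> carrier R \<and>
        (H, mat (dim_row H) (dim_row H) (\<lambda>(i, j). if i = j then \<one>\<^bsub>R\<^esub> else \<zero>\<^bsub>R\<^esub>)) \<in> S)"

definition pleasant :: "('r, 'm) ring_scheme \<Rightarrow> ('r, 'u) module rel \<Rightarrow> bool" where
  "pleasant R prec \<longleftrightarrow> (\<exists>S. pleasant_set R S \<and> prec = le_formulas R pp_arity pp_sat S)"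

text \<open>
  The triple \<open>(n, r, q)\<close> is the infinitary formula with \<open>n\<close> free variables and coefficients
  \<open>r i \<ell>\<close> and \<open>q i j\<close>, where \<open>i\<close> and \<open>\<ell>\<close> range over \<open>Field l\<close> for a cardinal \<open>l\<close>. Values of \<open>r\<close> and
  \<open>q\<close> at other indices are irrelevant.
\<close>

type_synonym ('r, 'u) E_form = "nat \<times> ('u \<Rightarrow> 'u \<Rightarrow> 'r) \<times> ('u \<Rightarrow> nat \<Rightarrow> 'r)"

definition E_form_wf :: "('r, 'm) ring_scheme \<Rightarrow> 'u rel \<Rightarrow> ('r, 'u) E_form \<Rightarrow> bool" where
  "E_form_wf R l = (\<lambda>(n, r, q).
     \<forall>i\<in>Field l. (\<forall>k\<in>Field l. r i k \<in> carrier R) \<and> (\<forall>j<n. q i j \<in> carrier R) \<and>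
       finite {k\<in>Field l. r i k \<noteq> \<zero>\<^bsub>R\<^esub>})"

definition E_sat ::
    "('r, 'm) ring_scheme \<Rightarrow> 'u rel \<Rightarrow> ('r, 'u) module \<Rightarrow> ('r, 'u) E_form \<Rightarrow> (nat \<Rightarrow> 'u) \<Rightarrow> bool" where
  "E_sat R l M = (\<lambda>(n, r, q) x.
     \<exists>v \<in> Field l \<rightarrow> carrier M. \<forall>i\<in>Field l.
       (\<Oplus>\<^bsub>M\<^esub>k\<in>{k\<in>Field l. r i k \<noteq> \<zero>\<^bsub>R\<^esub>}. r i k \<odot>\<^bsub>M\<^esub> v k)
         \<oplus>\<^bsub>M\<^esub> (\<Oplus>\<^bsub>M\<^esub>j\<in>{..<n}. q i j \<odot>\<^bsub>M\<^esub> x j) = \<zero>\<^bsub>M\<^esub>)"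

definition E_nice :: "('r, 'm) ring_scheme \<Rightarrow> ('r, 'u) module rel \<Rightarrow> bool" where
  "E_nice R prec \<longleftrightarrow>
     (\<exists>(l :: 'u rel) S. small_cardinal l \<and> cinfinite l \<and> |carrier R| \<le>o l \<and>
        (\<forall>\<phi>\<in>S. E_form_wf R l \<phi>) \<and> prec = le_formulas R fst (E_sat R l) S)"


section \<open>Galois types and stability\<close>

definition strong_embedding ::
    "('r, 'm) ring_scheme \<Rightarrow> ('r, 'u) module rel \<Rightarrow> ('r, 'u) module \<Rightarrow> ('r, 'u) module \<Rightarrow>
     ('u \<Rightarrow> 'u) set" where
  "strong_embedding R prec A B =
     {f \<in> mod_hom R A B. inj_on f (carrier A) \<and>
        (restrict_module R B (f ` carrier A), B) \<in> prec}"

text \<open>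
  A sequence is a function on an index type \<open>'i\<close>; sequences of different lengths are never related,
  so the index type may be fixed.
\<close>

type_synonym ('r, 'u, 'i) triple = "('i \<Rightarrow> 'u) \<times> 'u set \<times> ('r, 'u) module"

definition E_at ::
    "('r, 'm) ring_scheme \<Rightarrow> ('r, 'u) module set \<Rightarrow> ('r, 'u) module rel \<Rightarrow>
     ('r, 'u, 'i) triple rel" where
  "E_at R K prec =
     {((b1, X1, A1), (b2, X2, A2)).
        A1 \<in> K \<and> X1 \<subseteq> carrier A1 \<and> range b1 \<subseteq> carrier A1 \<and>
        A2 \<in> K \<and> X2 \<subseteq> carrier A2 \<and> range b2 \<subseteq> carrier A2 \<and>
        X1 = X2 \<and>
        (\<exists>A\<in>K. \<exists>f1\<in>strong_embedding R prec A1 A. \<exists>f2\<in>strong_embedding R prec A2 A.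
           (\<forall>x\<in>X1. f1 x = x \<and> f2 x = x) \<and> f1 \<circ> b1 = f2 \<circ> b2)}"

definition gtp ::
    "('r, 'm) ring_scheme \<Rightarrow> ('r, 'u) module set \<Rightarrow> ('r, 'u) module rel \<Rightarrow>
     ('i \<Rightarrow> 'u) \<Rightarrow> 'u set \<Rightarrow> ('r, 'u) module \<Rightarrow> ('r, 'u, 'i) triple set" where
  "gtp R K prec b X A = (E_at R K prec)\<^sup>+ `` {(b, X, A)}"

definition types_over ::
    "('r, 'm) ring_scheme \<Rightarrow> ('r, 'u) module set \<Rightarrow> ('r, 'u) module rel \<Rightarrow>
     ('r, 'u) module \<Rightarrow> ('r, 'u, unit) triple set set" where
  "types_over R K prec A =
     {gtp R K prec (\<lambda>_. b) (carrier A) B | b B. B \<in> K \<and> (A, B) \<in> prec \<and> b \<in> carrier B}"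

definition stable_in ::
    "('r, 'm) ring_scheme \<Rightarrow> ('r, 'u) module set \<Rightarrow> ('r, 'u) module rel \<Rightarrow> 'u rel \<Rightarrow> bool" where
  "stable_in R K prec l \<longleftrightarrow>
     small_cardinal l \<and> (\<exists>l0. LS_number R K prec l0 \<and> l0 \<le>o l) \<and>
     (\<forall>A\<in>K. |carrier A| =o l \<longrightarrow> |types_over R K prec A| \<le>o l)"

definition stable_class ::
    "('r, 'm) ring_scheme \<Rightarrow> ('r, 'u) module set \<Rightarrow> ('r, 'u) module rel \<Rightarrow> bool" where
  "stable_class R K prec \<longleftrightarrow>
     (\<forall>l :: 'u rel. small_cardinal l \<longrightarrow> (\<exists>l'. l \<le>o l' \<and> stable_in R K prec l'))"

end

theory Submission
  imports Defs "HOL-Algebra.Free_Abelian_Groups"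
begin

text \<open>
  Both halves come from one counting argument, in which the relation \<open>\<le>\<^sub>\<Sigma>\<close> is given by existential
  formulas \<open>\<exists>v. \<sigma>(x, v)\<close> whose matrix \<open>\<sigma>\<close> is a system of homogeneous linear equations and whose
  free variables \<open>x\<close> are finite in number. Positive primitive formulas and the infinitary formulas
  of E-nice relations are both of this kind. What matters is that the solutions \<open>(x, v)\<close> form a
  subgroup and that solving \<open>\<sigma>\<close> means the same in a submodule as in the whole module.

  Let \<open>A \<le>\<^sub>\<Sigma> B\<close> and \<open>b \<in> B\<close>, and let the infinite cardinal \<open>\<kappa>\<close> bound the number of formulas, the number of their
  quantified variables and the number of scalars. There is a submodule \<open>N\<close> of \<open>B\<close> with \<open>b \<in> N\<close>, at
  most \<open>\<kappa>\<close> elements, and \<open>N + A \<le>\<^sub>\<Sigma> B\<close>. Indeed, for a formula \<open>\<phi>\<close> and a tuple \<open>n\<close> in \<open>N\<close>, the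
  tuples \<open>a\<close> of \<open>A\<close> such that \<open>\<phi>(n + a)\<close> holds in \<open>B\<close> form, if there are any, a coset of the group of tuples
  of \<open>A\<close> that satisfy \<open>\<phi>\<close> in \<open>B\<close>, and these satisfy \<open>\<phi>\<close> already in \<open>A\<close>. So a single witness, for
  a single \<open>a\<close> in the coset, has to be put into \<open>N\<close>: the witnesses for all other \<open>a\<close> are obtained
  from it by adding elements of \<open>A\<close>. Hence \<open>N\<close> is a closure under \<open>\<kappa>\<close> many operations
  (\<open>small_hull\<close>).

  The inclusion of \<open>N + A\<close> in \<open>B\<close> is strong, so \<open>b\<close> has the same type over \<open>A\<close> in \<open>N + A\<close> as in
  \<open>B\<close>. And \<open>N + A\<close> is determined over \<open>A\<close>, up to isomorphism, by an enumeration \<open>e\<close> of \<open>N\<close> and the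
  knowledge of which combinations \<open>r e\<^sub>i + e\<^sub>j - e\<^sub>k\<close> lie in \<open>A\<close>, together with their values there
  (\<open>sum_isomorphism\<close>). This information is a function from a set of size \<open>\<kappa>\<close> to a set of size
  \<open>|A|\<close>, so for \<open>|A| = \<lambda>\<close> there are at most \<open>\<lambda>\<^sup>\<kappa>\<close> types over \<open>A\<close>.

  For a pleasant relation \<open>\<kappa> = |R| + \<aleph>\<^sub>0\<close> works, and the case \<open>A = 0\<close> of the hull construction
  bounds the Loewenheim-Skolem number. For an E-nice relation any sufficiently large \<open>\<kappa>\<close> below the
  inaccessible cardinal works, because \<open>\<lambda>\<^sup>\<kappa> = \<lambda>\<close> for every \<open>\<lambda>\<close> of the form \<open>2\<^sup>\<theta>\<close> with \<open>\<theta> \<ge> \<kappa>\<close>,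
  and there are unboundedly many of these.
\<close>


section \<open>Closure under infinitely many operations\<close>

text \<open>
  The operations are set-valued because one formula contributes a whole family of witnesses at once.
  They are finitary, so \<open>\<omega>\<close> stages suffice, and no stage exceeds \<open>|X| + |K|\<close>.
\<close>

lemma closure_under_operations:
  fixes F :: "'a list \<Rightarrow> 'a set" and X U :: "'a set" and K :: "'k set"
  assumes K: "infinite K" and XU: "X \<subseteq> U"
    and FU: "\<And>xs. xs \<in> lists U \<Longrightarrow> F xs \<subseteq> U" and FK: "\<And>xs. xs \<in> lists U \<Longrightarrow> |F xs| \<le>o |K|"
  obtains N where "X \<subseteq> N" "N \<subseteq> U" "\<And>xs. xs \<in> lists N \<Longrightarrow> F xs \<subseteq> N" "|N| \<le>o |X| +c |K|"
proof -
  define G where "G N = N \<union> (\<Union>xs\<in>lists N. F xs)" for N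
  define stage where "stage n = (G ^^ n) X" for n
  define Z where "Z = X <+> K"
  have Z: "infinite Z" and KZ: "|K| \<le>o |Z|"
    using K card_of_Plus2 unfolding Z_def by auto
  have stage_0: "stage 0 = X" and stage_Suc: "stage (Suc n) = G (stage n)" for n
    by (simp_all add: stage_def)
  have sub: "stage n \<subseteq> U" for n
  proof (induction n)
    case (Suc n)
    then have "lists (stage n) \<subseteq> lists U" by (rule lists_mono)
    with Suc show ?case using FU unfolding stage_Suc G_def by blast
  qed (simp add: stage_0 XU)
  have card: "|stage n| \<le>o |Z|" for n
  proof (induction n)
    case 0
    show ?case unfolding stage_0 Z_def by (rule card_of_Plus1)
  next
    case (Suc n)
    have "|lists (stage n)| \<le>o |lists Z|" using Suc by (rule card_of_lists_mono)
    also have "|lists Z| =o |Z|" using Z by (rule card_of_lists_infinite)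
    finally have "|lists (stage n)| \<le>o |Z|" .
    moreover have "\<forall>xs\<in>lists (stage n). |F xs| \<le>o |Z|"
      using FK lists_mono[OF sub] KZ ordLeq_transitive by blast
    ultimately have "|\<Union>xs\<in>lists (stage n). F xs| \<le>o |Z|"
      using Z card_of_UNION_ordLeq_infinite by blast
    with Suc show ?case unfolding stage_Suc G_def using Z card_of_Un_ordLeq_infinite by blast
  qed
  have mono: "stage m \<subseteq> stage n" if "m \<le> n" for m n
    using that lift_Suc_mono_le[of stage m n] by (auto simp: stage_Suc G_def)
  show ?thesis
  proof
    show "X \<subseteq> (\<Union>n. stage n)" using stage_0 by auto
    show "(\<Union>n. stage n) \<subseteq> U" using sub by blast
    have "|UNIV :: nat set| \<le>o |Z|" using Z infinite_iff_card_of_nat by blast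
    then have "|\<Union>n. stage n| \<le>o |Z|"
      using card_of_UNION_ordLeq_infinite[OF Z, of UNIV stage] card by blast
    then show "|\<Union>n. stage n| \<le>o |X| +c |K|" unfolding Z_def csum_def by (simp add: Field_card_of)
  next
    fix xs assume xs: "xs \<in> lists (\<Union>n. stage n)"
    have "\<exists>n. xs \<in> lists (stage n)"
      using xs
    proof (induction xs)
      case (Cons x xs)
      then obtain m n where "x \<in> stage m" "xs \<in> lists (stage n)" by auto
      then have "x # xs \<in> lists (stage (max m n))"
        using mono[of m "max m n"] mono[of n "max m n"] by auto
      then show ?case by blast
    qed simp
    then obtain n where "xs \<in> lists (stage n)" ..
    then have "F xs \<subseteq> stage (Suc n)" unfolding stage_Suc G_def by blast
    then show "F xs \<subseteq> (\<Union>n. stage n)" by blast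
  qed
qed


section \<open>Modules, submodules and linear combinations\<close>

lemma RMod_left_module: "M \<in> RMod R \<Longrightarrow> left_module R M"
  by (simp add: RMod_def)

lemma RMod_abelian_group: "M \<in> RMod R \<Longrightarrow> abelian_group M"
  by (simp add: RMod_def left_module_def)

lemma RMod_ring: "M \<in> RMod R \<Longrightarrow> ring R"
  by (simp add: RMod_def left_module_def)

lemma RMod_smult_closed:
  "M \<in> RMod R \<Longrightarrow> r \<in> carrier R \<Longrightarrow> x \<in> carrier M \<Longrightarrow> r \<odot>\<^bsub>M\<^esub> x \<in> carrier M"
  by (simp add: RMod_def left_module_def)

lemma RMod_add_smult:
  "M \<in> RMod R \<Longrightarrow> r \<in> carrier R \<Longrightarrow> s \<in> carrier R \<Longrightarrow> x \<in> carrier M \<Longrightarrow>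
     (r \<oplus>\<^bsub>R\<^esub> s) \<odot>\<^bsub>M\<^esub> x = r \<odot>\<^bsub>M\<^esub> x \<oplus>\<^bsub>M\<^esub> s \<odot>\<^bsub>M\<^esub> x"
  by (simp add: RMod_def left_module_def)

lemma RMod_smult_add:
  "M \<in> RMod R \<Longrightarrow> r \<in> carrier R \<Longrightarrow> x \<in> carrier M \<Longrightarrow> y \<in> carrier M \<Longrightarrow>
     r \<odot>\<^bsub>M\<^esub> (x \<oplus>\<^bsub>M\<^esub> y) = r \<odot>\<^bsub>M\<^esub> x \<oplus>\<^bsub>M\<^esub> r \<odot>\<^bsub>M\<^esub> y"
  by (simp add: RMod_def left_module_def)

lemma RMod_mult_smult:
  "M \<in> RMod R \<Longrightarrow> r \<in> carrier R \<Longrightarrow> s \<in> carrier R \<Longrightarrow> x \<in> carrier M \<Longrightarrow>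
     (r \<otimes>\<^bsub>R\<^esub> s) \<odot>\<^bsub>M\<^esub> x = r \<odot>\<^bsub>M\<^esub> (s \<odot>\<^bsub>M\<^esub> x)"
  by (simp add: RMod_def left_module_def)

lemma RMod_one_smult: "M \<in> RMod R \<Longrightarrow> x \<in> carrier M \<Longrightarrow> \<one>\<^bsub>R\<^esub> \<odot>\<^bsub>M\<^esub> x = x"
  by (simp add: RMod_def left_module_def)

lemma RMod_smult_funcset:
  assumes "M \<in> RMod R" "r \<in> J \<rightarrow> carrier R" "y \<in> J \<rightarrow> carrier M"
  shows "(\<lambda>j. r j \<odot>\<^bsub>M\<^esub> y j) \<in> J \<rightarrow> carrier M"
  using assms RMod_smult_closed by fast

lemma RMod_zero_smult:
  assumes M: "M \<in> RMod R" and x: "x \<in> carrier M"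
  shows "\<zero>\<^bsub>R\<^esub> \<odot>\<^bsub>M\<^esub> x = \<zero>\<^bsub>M\<^esub>"
proof -
  interpret R: ring R using M by (rule RMod_ring)
  interpret M: abelian_group M using M by (rule RMod_abelian_group)
  have "\<zero>\<^bsub>R\<^esub> \<odot>\<^bsub>M\<^esub> x \<oplus>\<^bsub>M\<^esub> \<zero>\<^bsub>R\<^esub> \<odot>\<^bsub>M\<^esub> x = \<zero>\<^bsub>R\<^esub> \<odot>\<^bsub>M\<^esub> x"
    using RMod_add_smult[OF M, of "\<zero>\<^bsub>R\<^esub>" "\<zero>\<^bsub>R\<^esub>" x] x by simp
  then show ?thesis using RMod_smult_closed[OF M _ x, of "\<zero>\<^bsub>R\<^esub>"] M.add.l_cancel_one by fastforce
qed

definition submodule_of ::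
    "('r, 'm) ring_scheme \<Rightarrow> ('r, 'u) module \<Rightarrow> 'u set \<Rightarrow> bool" where
  "submodule_of R M S \<longleftrightarrow>
     S \<subseteq> carrier M \<and> \<zero>\<^bsub>M\<^esub> \<in> S \<and> (\<forall>x\<in>S. \<forall>y\<in>S. x \<ominus>\<^bsub>M\<^esub> y \<in> S) \<and>
     (\<forall>r\<in>carrier R. \<forall>x\<in>S. r \<odot>\<^bsub>M\<^esub> x \<in> S)"

lemma submodule_of_inv:
  assumes "abelian_group M" "submodule_of R M S" "x \<in> S"
  shows "\<ominus>\<^bsub>M\<^esub> x \<in> S"
proof -
  interpret abelian_group M by fact
  have "x \<in> carrier M" "\<zero>\<^bsub>M\<^esub> \<ominus>\<^bsub>M\<^esub> x \<in> S" using assms(2,3) unfolding submodule_of_def by auto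
  then show ?thesis by (simp add: a_minus_def)
qed

lemma submodule_of_add:
  assumes "abelian_group M" "submodule_of R M S" "x \<in> S" "y \<in> S"
  shows "x \<oplus>\<^bsub>M\<^esub> y \<in> S"
proof -
  interpret abelian_group M by fact
  have "x \<in> carrier M" "y \<in> carrier M" "x \<ominus>\<^bsub>M\<^esub> (\<ominus>\<^bsub>M\<^esub> y) \<in> S"
    using assms submodule_of_inv[OF assms(1,2,4)] unfolding submodule_of_def by auto
  then show ?thesis by (simp add: a_minus_def)
qed

lemma restrict_module_simps [simp]:
  "carrier (restrict_module R M S) = S"
  "\<zero>\<^bsub>restrict_module R M S\<^esub> = \<zero>\<^bsub>M\<^esub>"
  "x \<in> S \<Longrightarrow> y \<in> S \<Longrightarrow> x \<oplus>\<^bsub>restrict_module R M S\<^esub> y = x \<oplus>\<^bsub>M\<^esub> y"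
  "r \<in> carrier R \<Longrightarrow> x \<in> S \<Longrightarrow> r \<odot>\<^bsub>restrict_module R M S\<^esub> x = r \<odot>\<^bsub>M\<^esub> x"
  by (simp_all add: restrict_module_def)

lemma restrict_module_in_RMod:
  fixes M :: "('r, 'u) module"
  assumes M: "M \<in> RMod R" and S: "submodule_of R M S"
  shows "restrict_module R M S \<in> RMod R"
proof -
  let ?S = "restrict_module R M S"
  interpret R: ring R using M by (rule RMod_ring)
  interpret M: abelian_group M using M by (rule RMod_abelian_group)
  have sub: "x \<in> carrier M" if "x \<in> S" for x using S that unfolding submodule_of_def by auto
  note add = submodule_of_add[OF M.abelian_group_axioms S]
    and inv = submodule_of_inv[OF M.abelian_group_axioms S]
  have zero: "\<zero>\<^bsub>M\<^esub> \<in> S" and smult: "r \<odot>\<^bsub>M\<^esub> x \<in> S" if "r \<in> carrier R" "x \<in> S" for r x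
    using S that unfolding submodule_of_def by auto
  have "abelian_group ?S"
  proof (rule abelian_groupI)
    show "\<exists>y\<in>carrier ?S. y \<oplus>\<^bsub>?S\<^esub> x = \<zero>\<^bsub>?S\<^esub>" if "x \<in> carrier ?S" for x
      using that inv[of x] sub by (auto intro!: bexI[of _ "\<ominus>\<^bsub>M\<^esub> x"] simp: M.l_neg)
  qed (use add zero sub S in \<open>auto simp: M.a_ac submodule_of_def\<close>)
  moreover have "|S| <o |UNIV :: 'u set|"
    using M S card_of_mono1 ordLeq_ordLess_trans unfolding RMod_def submodule_of_def by blast
  moreover have "left_module R ?S \<longleftrightarrow> abelian_group ?S"
    using add smult sub RMod_add_smult[OF M] RMod_smult_add[OF M] RMod_mult_smult[OF M] RMod_one_smult[OF M]
    unfolding left_module_def by (auto simp: R.ring_axioms)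
  ultimately show ?thesis by (simp add: RMod_def) (simp add: restrict_module_def fun_eq_iff)
qed

lemma restrict_module_carrier: "M \<in> RMod R \<Longrightarrow> restrict_module R M (carrier M) = M"
  by (simp add: RMod_def)

lemma substructure_restrict_module: "S \<subseteq> carrier M \<Longrightarrow> substructure R (restrict_module R M S) M"
  by (simp add: substructure_def)

lemma substructure_simps:
  assumes "substructure R A B"
  shows "x \<in> carrier A \<Longrightarrow> x \<in> carrier B"
    and "\<zero>\<^bsub>A\<^esub> = \<zero>\<^bsub>B\<^esub>"
    and "x \<in> carrier A \<Longrightarrow> y \<in> carrier A \<Longrightarrow> x \<oplus>\<^bsub>A\<^esub> y = x \<oplus>\<^bsub>B\<^esub> y"
    and "r \<in> carrier R \<Longrightarrow> x \<in> carrier A \<Longrightarrow> r \<odot>\<^bsub>A\<^esub> x = r \<odot>\<^bsub>B\<^esub> x"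
proof -
  have A: "A = restrict_module R B (carrier A)" and sub: "carrier A \<subseteq> carrier B"
    using assms unfolding substructure_def by auto
  show "x \<in> carrier A \<Longrightarrow> x \<in> carrier B" using sub by auto
  show "\<zero>\<^bsub>A\<^esub> = \<zero>\<^bsub>B\<^esub>" by (subst A) simp
  show "x \<in> carrier A \<Longrightarrow> y \<in> carrier A \<Longrightarrow> x \<oplus>\<^bsub>A\<^esub> y = x \<oplus>\<^bsub>B\<^esub> y" by (subst A) simp
  show "r \<in> carrier R \<Longrightarrow> x \<in> carrier A \<Longrightarrow> r \<odot>\<^bsub>A\<^esub> x = r \<odot>\<^bsub>B\<^esub> x" by (subst A) simp
qed

lemma substructure_a_minus:
  assumes "A \<in> RMod R" "B \<in> RMod R" "substructure R A B" "x \<in> carrier A" "y \<in> carrier A"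
  shows "x \<ominus>\<^bsub>A\<^esub> y = x \<ominus>\<^bsub>B\<^esub> y"
proof -
  interpret A: abelian_group A using assms(1) by (rule RMod_abelian_group)
  interpret B: abelian_group B using assms(2) by (rule RMod_abelian_group)
  note sub = substructure_simps[OF assms(3)]
  have "(\<ominus>\<^bsub>A\<^esub> y) \<oplus>\<^bsub>B\<^esub> y = \<zero>\<^bsub>B\<^esub>"
    using A.l_neg[OF assms(5)] assms(5) sub by simp
  then have "\<ominus>\<^bsub>A\<^esub> y = \<ominus>\<^bsub>B\<^esub> y"
    using assms(5) sub(1) A.a_inv_closed B.minus_equality by metis
  moreover have "\<ominus>\<^bsub>A\<^esub> y \<in> carrier A" using assms(5) by simp
  ultimately show ?thesis using assms(4) sub(3)[of x "\<ominus>\<^bsub>A\<^esub> y"] by (simp add: a_minus_def)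
qed

lemma substructure_submodule_of:
  assumes "A \<in> RMod R" "B \<in> RMod R" "substructure R A B"
  shows "submodule_of R B (carrier A)"
proof -
  interpret A: abelian_group A using assms(1) by (rule RMod_abelian_group)
  show ?thesis
    unfolding submodule_of_def
  proof (intro conjI ballI)
    fix x y assume "x \<in> carrier A" "y \<in> carrier A"
    then show "x \<ominus>\<^bsub>B\<^esub> y \<in> carrier A"
      using substructure_a_minus[OF assms] A.minus_closed by metis
  next
    fix r x assume "r \<in> carrier R" "x \<in> carrier A"
    then show "r \<odot>\<^bsub>B\<^esub> x \<in> carrier A"
      using substructure_simps(4)[OF assms(3)] RMod_smult_closed[OF assms(1)] by metis
  qed (use substructure_simps[OF assms(3)] A.zero_closed in auto)
qed

lemma (in abelian_group) add_eq_add_iff_diff: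
  assumes "x \<in> carrier G" "a \<in> carrier G" "y \<in> carrier G" "b \<in> carrier G"
  shows "x \<oplus> a = y \<oplus> b \<longleftrightarrow> x \<ominus> y = b \<ominus> a"
proof -
  have "(x \<ominus> y) \<oplus> (y \<oplus> a) = x \<oplus> a"
    using assms by (simp add: a_minus_def a_assoc r_neg1)
  moreover have "(b \<ominus> a) \<oplus> (a \<oplus> y) = b \<oplus> y"
    using assms by (simp add: a_minus_def a_assoc r_neg1)
  ultimately show ?thesis
    using assms add.right_cancel[of "y \<oplus> a" "x \<ominus> y" "b \<ominus> a"] by (simp add: a_comm)
qed

lemma (in abelian_group) diff_eq_zero_iff:
  assumes "x \<in> carrier G" "y \<in> carrier G"
  shows "x \<ominus> y = \<zero> \<longleftrightarrow> x = y"
  using add_eq_add_iff_diff[of x \<zero> y \<zero>] assms by (auto simp: a_minus_def r_neg)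

lemma (in abelian_group) add_diff_cancel:
  assumes "x \<in> carrier G" "y \<in> carrier G"
  shows "x \<oplus> (y \<ominus> x) = y"
  using assms by (simp add: a_minus_def a_comm[of y] r_neg2)

definition sum_of_sets :: "('r, 'u) module \<Rightarrow> 'u set \<Rightarrow> 'u set \<Rightarrow> 'u set" where
  "sum_of_sets M S T = {s \<oplus>\<^bsub>M\<^esub> t | s t. s \<in> S \<and> t \<in> T}"

lemma (in abelian_group) add_diff_add:
  assumes "a \<in> carrier G" "b \<in> carrier G" "c \<in> carrier G" "d \<in> carrier G"
  shows "(a \<oplus> b) \<ominus> (c \<oplus> d) = (a \<ominus> c) \<oplus> (b \<ominus> d)"
  using assms by (simp add: a_minus_def minus_add a_ac)

lemma submodule_of_sum:
  assumes M: "M \<in> RMod R" and S: "submodule_of R M S" and T: "submodule_of R M T"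
  shows "submodule_of R M (sum_of_sets M S T)" "S \<subseteq> sum_of_sets M S T" "T \<subseteq> sum_of_sets M S T"
proof -
  interpret M: abelian_group M using M by (rule RMod_abelian_group)
  have sub: "\<And>x. x \<in> S \<Longrightarrow> x \<in> carrier M" "\<And>x. x \<in> T \<Longrightarrow> x \<in> carrier M"
    and zero: "\<zero>\<^bsub>M\<^esub> \<in> S" "\<zero>\<^bsub>M\<^esub> \<in> T"
    using S T unfolding submodule_of_def by auto
  show S': "S \<subseteq> sum_of_sets M S T"
    unfolding sum_of_sets_def using zero sub by (force intro: M.r_zero[symmetric])
  show "T \<subseteq> sum_of_sets M S T"
    unfolding sum_of_sets_def using zero sub by (force intro: M.l_zero[symmetric])
  show "submodule_of R M (sum_of_sets M S T)"
    unfolding submodule_of_def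
  proof (intro conjI ballI)
    show "sum_of_sets M S T \<subseteq> carrier M" unfolding sum_of_sets_def using sub by auto
    show "\<zero>\<^bsub>M\<^esub> \<in> sum_of_sets M S T" using S' zero by auto
  next
    fix x y assume "x \<in> sum_of_sets M S T" "y \<in> sum_of_sets M S T"
    then obtain s t s' t' where "s \<in> S" "t \<in> T" "s' \<in> S" "t' \<in> T"
      and "x = s \<oplus>\<^bsub>M\<^esub> t" "y = s' \<oplus>\<^bsub>M\<^esub> t'"
      unfolding sum_of_sets_def by auto
    moreover from this have "x \<ominus>\<^bsub>M\<^esub> y = (s \<ominus>\<^bsub>M\<^esub> s') \<oplus>\<^bsub>M\<^esub> (t \<ominus>\<^bsub>M\<^esub> t')"
      using sub M.add_diff_add by simp
    ultimately show "x \<ominus>\<^bsub>M\<^esub> y \<in> sum_of_sets M S T"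
      using S T unfolding sum_of_sets_def submodule_of_def by blast
  next
    fix r x assume r: "r \<in> carrier R" and "x \<in> sum_of_sets M S T"
    then obtain s t where "s \<in> S" "t \<in> T" "x = s \<oplus>\<^bsub>M\<^esub> t"
      unfolding sum_of_sets_def by auto
    moreover from this have "r \<odot>\<^bsub>M\<^esub> x = r \<odot>\<^bsub>M\<^esub> s \<oplus>\<^bsub>M\<^esub> r \<odot>\<^bsub>M\<^esub> t"
      using sub RMod_smult_add[OF M r] by simp
    ultimately show "r \<odot>\<^bsub>M\<^esub> x \<in> sum_of_sets M S T"
      using S T r unfolding sum_of_sets_def submodule_of_def by blast
  qed
qed

definition lin :: "('r, 'u) module \<Rightarrow> ('i \<Rightarrow> 'r) \<Rightarrow> 'i set \<Rightarrow> ('i \<Rightarrow> 'u) \<Rightarrow> 'u" where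
  "lin M r J y = (\<Oplus>\<^bsub>M\<^esub>j\<in>J. r j \<odot>\<^bsub>M\<^esub> y j)"

lemma lin_closed:
  assumes "M \<in> RMod R" "r \<in> J \<rightarrow> carrier R" "y \<in> J \<rightarrow> carrier M"
  shows "lin M r J y \<in> carrier M"
proof -
  interpret M: abelian_group M using assms(1) by (rule RMod_abelian_group)
  show ?thesis unfolding lin_def using assms RMod_smult_closed[OF assms(1)]
    by (intro M.finsum_closed) auto
qed

lemma lin_cong:
  assumes "M \<in> RMod R" "r \<in> J \<rightarrow> carrier R" "y \<in> J \<rightarrow> carrier M" "\<And>j. j \<in> J \<Longrightarrow> y j = y' j"
  shows "lin M r J y = lin M r J y'"
proof -
  interpret M: abelian_group M using assms(1) by (rule RMod_abelian_group)
  show ?thesis unfolding lin_def using RMod_smult_funcset[OF assms(1,2)] assms(3,4)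
    by (intro M.finsum_cong') (auto simp: Pi_iff)
qed

lemma lin_add:
  assumes M: "M \<in> RMod R" and r: "r \<in> J \<rightarrow> carrier R"
    and y: "y \<in> J \<rightarrow> carrier M" "y' \<in> J \<rightarrow> carrier M"
  shows "lin M r J (\<lambda>j. y j \<oplus>\<^bsub>M\<^esub> y' j) = lin M r J y \<oplus>\<^bsub>M\<^esub> lin M r J y'"
proof -
  interpret M: abelian_group M using M by (rule RMod_abelian_group)
  have "lin M r J (\<lambda>j. y j \<oplus>\<^bsub>M\<^esub> y' j) = (\<Oplus>\<^bsub>M\<^esub>j\<in>J. r j \<odot>\<^bsub>M\<^esub> y j \<oplus>\<^bsub>M\<^esub> r j \<odot>\<^bsub>M\<^esub> y' j)"
    unfolding lin_def
  proof (intro M.finsum_cong')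
    fix j assume j: "j \<in> J"
    from r y j have "r j \<in> carrier R" "y j \<in> carrier M" "y' j \<in> carrier M" by auto
    then show "r j \<odot>\<^bsub>M\<^esub> (y j \<oplus>\<^bsub>M\<^esub> y' j) = r j \<odot>\<^bsub>M\<^esub> y j \<oplus>\<^bsub>M\<^esub> r j \<odot>\<^bsub>M\<^esub> y' j"
      using RMod_smult_add[OF M] by blast
  qed (use RMod_smult_funcset[OF M r] y M.add.m_closed in \<open>auto simp: Pi_iff\<close>)
  also have "\<dots> = lin M r J y \<oplus>\<^bsub>M\<^esub> lin M r J y'"
    unfolding lin_def using RMod_smult_funcset[OF M r] y by (intro M.finsum_addf) auto
  finally show ?thesis .
qed

text \<open>
  Compatibility with differences follows from additivity alone: \<open>y = (y - y') + y'\<close>.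
\<close>

lemma lin_diff:
  assumes M: "M \<in> RMod R" and r: "r \<in> J \<rightarrow> carrier R"
    and y: "y \<in> J \<rightarrow> carrier M" "y' \<in> J \<rightarrow> carrier M"
  shows "lin M r J (\<lambda>j. y j \<ominus>\<^bsub>M\<^esub> y' j) = lin M r J y \<ominus>\<^bsub>M\<^esub> lin M r J y'"
proof -
  interpret M: abelian_group M using M by (rule RMod_abelian_group)
  let ?d = "\<lambda>j. y j \<ominus>\<^bsub>M\<^esub> y' j"
  have d: "?d \<in> J \<rightarrow> carrier M" using y by auto
  have eq: "y j = ?d j \<oplus>\<^bsub>M\<^esub> y' j" if "j \<in> J" for j
    using funcset_mem[OF y(1) that] funcset_mem[OF y(2) that]
    by (simp add: a_minus_def M.a_assoc M.l_neg)
  have "lin M r J y = lin M r J (\<lambda>j. ?d j \<oplus>\<^bsub>M\<^esub> y' j)"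
    by (rule lin_cong[OF M r y(1)]) (rule eq)
  also have "\<dots> = lin M r J ?d \<oplus>\<^bsub>M\<^esub> lin M r J y'"
    by (rule lin_add[OF M r d y(2)])
  finally show ?thesis
    using lin_closed[OF M r d] lin_closed[OF M r y(2)]
    by (simp add: a_minus_def M.a_assoc M.r_neg)
qed

lemma lin_substructure:
  assumes A: "A \<in> RMod R" and B: "B \<in> RMod R" and AB: "substructure R A B"
    and "r \<in> J \<rightarrow> carrier R" "y \<in> J \<rightarrow> carrier A" and J: "finite J"
  shows "lin A r J y = lin B r J y"
  using J assms(4,5)
proof (induction J)
  interpret A: abelian_group A using A by (rule RMod_abelian_group)
  interpret B: abelian_group B using B by (rule RMod_abelian_group)
  note sub = substructure_simps[OF AB]
  case empty
  then show ?case by (simp add: lin_def sub)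
next
  interpret A: abelian_group A using A by (rule RMod_abelian_group)
  interpret B: abelian_group B using B by (rule RMod_abelian_group)
  note sub = substructure_simps[OF AB]
  case (insert j J)
  have r: "r j \<in> carrier R" "r \<in> J \<rightarrow> carrier R" and y: "y j \<in> carrier A" "y \<in> J \<rightarrow> carrier A"
    using insert.prems by auto
  have yB: "y j \<in> carrier B" "y \<in> J \<rightarrow> carrier B" using y sub(1) by auto
  have "lin A r (insert j J) y = r j \<odot>\<^bsub>A\<^esub> y j \<oplus>\<^bsub>A\<^esub> lin A r J y"
    unfolding lin_def using insert.hyps r y RMod_smult_closed[OF A]
    by (intro A.finsum_insert) auto
  also have "\<dots> = r j \<odot>\<^bsub>B\<^esub> y j \<oplus>\<^bsub>B\<^esub> lin B r J y"
    using sub r y RMod_smult_closed[OF A r(1) y(1)] lin_closed[OF A r(2) y(2)] insert.IH[OF r(2) y(2)]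
    by (metis)
  also have "\<dots> = lin B r (insert j J) y"
    unfolding lin_def using insert.hyps r yB RMod_smult_closed[OF B]
    by (intro B.finsum_insert[symmetric]) auto
  finally show ?case .
qed

text \<open>
  Where direct summands are strong, the zero submodule is strong in every module, and hulls over it
  are strong submodules by themselves; this turns hulls into Loewenheim-Skolem bounds.
\<close>

lemma zero_direct_summand:
  assumes B: "B \<in> RMod R"
  shows "direct_summand R (restrict_module R B {\<zero>\<^bsub>B\<^esub>}) B"
proof -
  interpret B: abelian_group B using B by (rule RMod_abelian_group)
  have "r \<odot>\<^bsub>B\<^esub> \<zero>\<^bsub>B\<^esub> = \<zero>\<^bsub>B\<^esub>" if "r \<in> carrier R" for r
  proof -
    have "r \<odot>\<^bsub>B\<^esub> \<zero>\<^bsub>B\<^esub> \<oplus>\<^bsub>B\<^esub> r \<odot>\<^bsub>B\<^esub> \<zero>\<^bsub>B\<^esub> = r \<odot>\<^bsub>B\<^esub> \<zero>\<^bsub>B\<^esub>"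
      using RMod_smult_add[OF B that, of "\<zero>\<^bsub>B\<^esub>" "\<zero>\<^bsub>B\<^esub>"] by simp
    then show ?thesis using RMod_smult_closed[OF B that] B.add.l_cancel_one by fastforce
  qed
  then have sub: "submodule_of R B {\<zero>\<^bsub>B\<^esub>}"
    unfolding submodule_of_def by (simp add: a_minus_def B.r_neg)
  have B': "substructure R B B" using B unfolding substructure_def RMod_def by simp
  show ?thesis
    unfolding direct_summand_def
  proof (intro conjI bexI[of _ B])
    show "carrier (restrict_module R B {\<zero>\<^bsub>B\<^esub>}) \<inter> carrier B = {\<zero>\<^bsub>B\<^esub>}" by auto
    show "carrier B = {a \<oplus>\<^bsub>B\<^esub> c |a c. a \<in> carrier (restrict_module R B {\<zero>\<^bsub>B\<^esub>}) \<and> c \<in> carrier B}"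
      by force
  qed (use B B' restrict_module_in_RMod[OF B sub] substructure_restrict_module[of "{\<zero>\<^bsub>B\<^esub>}" B] in auto)
qed


section \<open>Existential linear formulas and small hulls\<close>

text \<open>
  The only properties of a formula \<open>\<exists>v. \<sigma>(x, v)\<close> that the counting argument sees: \<open>sol M \<phi> x v\<close> is
  \<open>\<sigma>(x, v)\<close> in \<open>M\<close>, \<open>ar \<phi>\<close> the number of free variables, and \<open>ix \<phi>\<close> the index set of the
  quantified variables, which may be infinite.
\<close>

locale existential_linear_formulas =
  fixes R :: "('r, 'm) ring_scheme"
    and ar :: "'f \<Rightarrow> nat"
    and ix :: "'f \<Rightarrow> 'i set"
    and sol :: "('r, 'u) module \<Rightarrow> 'f \<Rightarrow> (nat \<Rightarrow> 'u) \<Rightarrow> ('i \<Rightarrow> 'u) \<Rightarrow> bool"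
    and sat :: "('r, 'u) module \<Rightarrow> 'f \<Rightarrow> (nat \<Rightarrow> 'u) \<Rightarrow> bool"
    and S :: "'f set"
  assumes sat_iff: "\<lbrakk>\<phi> \<in> S; M \<in> RMod R; x \<in> {..<ar \<phi>} \<rightarrow> carrier M\<rbrakk> \<Longrightarrow>
        sat M \<phi> x \<longleftrightarrow> (\<exists>v \<in> ix \<phi> \<rightarrow> carrier M. sol M \<phi> x v)"
    and sol_substructure: "\<lbrakk>\<phi> \<in> S; A \<in> RMod R; B \<in> RMod R; substructure R A B;
        x \<in> {..<ar \<phi>} \<rightarrow> carrier A; v \<in> ix \<phi> \<rightarrow> carrier A\<rbrakk> \<Longrightarrow> sol A \<phi> x v \<longleftrightarrow> sol B \<phi> x v"
    and sol_cong: "\<lbrakk>\<phi> \<in> S; M \<in> RMod R; x \<in> {..<ar \<phi>} \<rightarrow> carrier M; v \<in> ix \<phi> \<rightarrow> carrier M;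
        sol M \<phi> x v; \<And>j. j < ar \<phi> \<Longrightarrow> x j = x' j; \<And>k. k \<in> ix \<phi> \<Longrightarrow> v k = v' k\<rbrakk> \<Longrightarrow> sol M \<phi> x' v'"
    and sol_add: "\<lbrakk>\<phi> \<in> S; M \<in> RMod R; x \<in> {..<ar \<phi>} \<rightarrow> carrier M; v \<in> ix \<phi> \<rightarrow> carrier M;
        x' \<in> {..<ar \<phi>} \<rightarrow> carrier M; v' \<in> ix \<phi> \<rightarrow> carrier M; sol M \<phi> x v; sol M \<phi> x' v'\<rbrakk> \<Longrightarrow>
        sol M \<phi> (\<lambda>j. x j \<oplus>\<^bsub>M\<^esub> x' j) (\<lambda>k. v k \<oplus>\<^bsub>M\<^esub> v' k)"
    and sol_diff: "\<lbrakk>\<phi> \<in> S; M \<in> RMod R; x \<in> {..<ar \<phi>} \<rightarrow> carrier M; v \<in> ix \<phi> \<rightarrow> carrier M;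
        x' \<in> {..<ar \<phi>} \<rightarrow> carrier M; v' \<in> ix \<phi> \<rightarrow> carrier M; sol M \<phi> x v; sol M \<phi> x' v'\<rbrakk> \<Longrightarrow>
        sol M \<phi> (\<lambda>j. x j \<ominus>\<^bsub>M\<^esub> x' j) (\<lambda>k. v k \<ominus>\<^bsub>M\<^esub> v' k)"
begin

text \<open>
  The coset argument. The premise on witnesses asks of \<open>N\<close> only that, whenever \<open>\<phi>(n + a)\<close> holds in
  \<open>B\<close> for some \<open>a\<close> from \<open>A\<close>, there is one such \<open>a\<close> for which a witness lies in \<open>N\<close>.
\<close>

lemma sum_elementary:
  assumes AB: "(A, B) \<in> le_formulas R ar sat S" and N: "submodule_of R B N"
    and witness: "\<And>\<phi> xs a v. \<lbrakk>\<phi> \<in> S; xs \<in> lists N; length xs = ar \<phi>; a \<in> {..<ar \<phi>} \<rightarrow> carrier A;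
        v \<in> ix \<phi> \<rightarrow> carrier B; sol B \<phi> (\<lambda>j. xs ! j \<oplus>\<^bsub>B\<^esub> a j) v\<rbrakk> \<Longrightarrow>
        \<exists>a' \<in> {..<ar \<phi>} \<rightarrow> carrier A. \<exists>v' \<in> ix \<phi> \<rightarrow> N. sol B \<phi> (\<lambda>j. xs ! j \<oplus>\<^bsub>B\<^esub> a' j) v'"
  shows "(restrict_module R B (sum_of_sets B N (carrier A)), B) \<in> le_formulas R ar sat S"
proof -
  let ?T = "sum_of_sets B N (carrier A)"
  let ?C = "restrict_module R B ?T"
  have A: "A \<in> RMod R" and B: "B \<in> RMod R" and sub: "substructure R A B"
    and AB_sat: "\<And>\<phi> a. \<phi> \<in> S \<Longrightarrow> a \<in> {..<ar \<phi>} \<rightarrow> carrier A \<Longrightarrow> sat A \<phi> a \<longleftrightarrow> sat B \<phi> a"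
    using AB unfolding le_formulas_def by auto
  interpret B: abelian_group B using B by (rule RMod_abelian_group)
  have AB_carrier: "carrier A \<subseteq> carrier B" and NB: "N \<subseteq> carrier B"
    using sub N unfolding substructure_def submodule_of_def by auto
  have subA: "submodule_of R B (carrier A)" using substructure_submodule_of[OF A B sub] .
  note T = submodule_of_sum[OF B N subA]
  have C: "?C \<in> RMod R" using restrict_module_in_RMod[OF B T(1)] .
  have TB: "?T \<subseteq> carrier B" using T(1) unfolding submodule_of_def by auto
  have CB: "substructure R ?C B" using substructure_restrict_module[OF TB] .
  have "sat ?C \<phi> x \<longleftrightarrow> sat B \<phi> x" if \<phi>: "\<phi> \<in> S" and x: "x \<in> {..<ar \<phi>} \<rightarrow> carrier ?C" for \<phi> x
  proof
    have xB: "x \<in> {..<ar \<phi>} \<rightarrow> carrier B" using x TB by auto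
    {
      assume "sat ?C \<phi> x"
      then obtain v where v: "v \<in> ix \<phi> \<rightarrow> carrier ?C" "sol ?C \<phi> x v"
        using sat_iff[OF \<phi> C x] by auto
      then have "sol B \<phi> x v" "v \<in> ix \<phi> \<rightarrow> carrier B"
        using sol_substructure[OF \<phi> C B CB x v(1)] TB by auto
      then show "sat B \<phi> x" using sat_iff[OF \<phi> B xB] by auto
    next
      assume "sat B \<phi> x"
      then obtain v where v: "v \<in> ix \<phi> \<rightarrow> carrier B" and sol_v: "sol B \<phi> x v"
        using sat_iff[OF \<phi> B xB] by auto
      have "\<forall>j<ar \<phi>. \<exists>n a. n \<in> N \<and> a \<in> carrier A \<and> x j = n \<oplus>\<^bsub>B\<^esub> a"
        using x unfolding sum_of_sets_def by (simp add: Pi_iff) blast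
      then obtain n a where na: "\<And>j. j < ar \<phi> \<Longrightarrow> n j \<in> N \<and> a j \<in> carrier A \<and> x j = n j \<oplus>\<^bsub>B\<^esub> a j"
        by metis
      define xs where "xs = map n [0..<ar \<phi>]"
      have xs: "xs \<in> lists N" "length xs = ar \<phi>" and xs_nth: "\<And>j. j < ar \<phi> \<Longrightarrow> xs ! j = n j"
        unfolding xs_def using na by auto
      have a: "a \<in> {..<ar \<phi>} \<rightarrow> carrier A" using na by auto
      have "sol B \<phi> (\<lambda>j. xs ! j \<oplus>\<^bsub>B\<^esub> a j) v"
        by (rule sol_cong[OF \<phi> B xB v sol_v]) (simp_all add: na xs_nth)
      then obtain a0 v0 where a0: "a0 \<in> {..<ar \<phi>} \<rightarrow> carrier A" and v0: "v0 \<in> ix \<phi> \<rightarrow> N"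
        and sol0: "sol B \<phi> (\<lambda>j. xs ! j \<oplus>\<^bsub>B\<^esub> a0 j) v0"
        using witness[OF \<phi> xs a v] by auto
      let ?y = "\<lambda>j. xs ! j \<oplus>\<^bsub>B\<^esub> a0 j" and ?d = "\<lambda>j. a j \<ominus>\<^bsub>A\<^esub> a0 j"
      have yB: "?y \<in> {..<ar \<phi>} \<rightarrow> carrier B" and v0B: "v0 \<in> ix \<phi> \<rightarrow> carrier B"
        using a0 v0 na NB AB_carrier by (auto simp: Pi_iff xs_nth subset_iff)
      interpret A: abelian_group A using A by (rule RMod_abelian_group)
      have d: "?d \<in> {..<ar \<phi>} \<rightarrow> carrier A" using a a0 by auto
      then have dB: "?d \<in> {..<ar \<phi>} \<rightarrow> carrier B" using AB_carrier by auto
      have d_eq: "x j \<ominus>\<^bsub>B\<^esub> ?y j = ?d j" "?y j \<oplus>\<^bsub>B\<^esub> ?d j = x j" if "j < ar \<phi>" for j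
      proof -
        have 1: "n j \<in> carrier B" "a j \<in> carrier B" "a0 j \<in> carrier B" "a j \<in> carrier A" "a0 j \<in> carrier A"
          using na[OF that] a0 that NB AB_carrier by auto
        then have "?d j = a j \<ominus>\<^bsub>B\<^esub> a0 j" using substructure_a_minus[OF A B sub] by blast
        moreover have "x j \<ominus>\<^bsub>B\<^esub> ?y j = (n j \<ominus>\<^bsub>B\<^esub> n j) \<oplus>\<^bsub>B\<^esub> (a j \<ominus>\<^bsub>B\<^esub> a0 j)"
          using 1 na[OF that] xs_nth[OF that] B.add_diff_add by simp
        moreover have "?y j \<oplus>\<^bsub>B\<^esub> (a j \<ominus>\<^bsub>B\<^esub> a0 j) = n j \<oplus>\<^bsub>B\<^esub> (a0 j \<oplus>\<^bsub>B\<^esub> (a j \<ominus>\<^bsub>B\<^esub> a0 j))"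
          using 1 xs_nth[OF that] by (simp add: B.a_assoc)
        ultimately show "x j \<ominus>\<^bsub>B\<^esub> ?y j = ?d j" "?y j \<oplus>\<^bsub>B\<^esub> ?d j = x j"
          using 1 na[OF that] B.add_diff_cancel by (simp_all add: B.diff_eq_zero_iff)
      qed
      \<comment> \<open>The difference of the two parameter tuples satisfies \<open>\<phi>\<close> in \<open>B\<close>, hence in \<open>A\<close>: this is
          where \<open>A \<le>\<^sub>\<Sigma> B\<close> enters.\<close>
      have "sol B \<phi> ?d (\<lambda>k. v k \<ominus>\<^bsub>B\<^esub> v0 k)"
        by (rule sol_cong[OF \<phi> B _ _ sol_diff[OF \<phi> B xB v yB v0B sol_v sol0]])
           (use dB v v0B d_eq(1) xB yB B.minus_closed in \<open>auto simp: Pi_iff\<close>)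
      moreover have "(\<lambda>k. v k \<ominus>\<^bsub>B\<^esub> v0 k) \<in> ix \<phi> \<rightarrow> carrier B"
        using v v0B by (auto simp: Pi_iff)
      ultimately have "sat B \<phi> ?d" using sat_iff[OF \<phi> B dB] by blast
      then have "sat A \<phi> ?d" using AB_sat[OF \<phi> d] by simp
      then obtain w where w: "w \<in> ix \<phi> \<rightarrow> carrier A" "sol A \<phi> ?d w"
        using sat_iff[OF \<phi> A d] by auto
      have wB: "w \<in> ix \<phi> \<rightarrow> carrier B" using w(1) AB_carrier by auto
      have sol_w: "sol B \<phi> ?d w" using sol_substructure[OF \<phi> A B sub d w(1)] w(2) by simp
      let ?u = "\<lambda>k. v0 k \<oplus>\<^bsub>B\<^esub> w k"
      have u: "?u \<in> ix \<phi> \<rightarrow> carrier ?C"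
        using v0 w(1) unfolding sum_of_sets_def by (auto simp: Pi_iff)
      have "sol B \<phi> x ?u"
        by (rule sol_cong[OF \<phi> B _ _ sol_add[OF \<phi> B yB v0B dB wB sol0 sol_w]])
           (use xB yB dB v0B wB d_eq(2) in \<open>auto simp: Pi_iff\<close>)
      then have "sol ?C \<phi> x ?u" using sol_substructure[OF \<phi> C B CB x u] by simp
      then show "sat ?C \<phi> x" using sat_iff[OF \<phi> C x] u by blast
    }
  qed
  then show ?thesis unfolding le_formulas_def using C B CB by simp
qed

text \<open>
  \<open>N\<close> is generated from \<open>X\<close> by the module operations and one chosen witness family for each formula
  \<open>\<phi>\<close> and tuple \<open>n\<close> such that \<open>\<phi>(n + a)\<close> holds in \<open>B\<close> for some \<open>a\<close> from \<open>A\<close>. Since \<open>a\<close> is not an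
  argument of the choice, the size of \<open>A\<close> does not enter the bound.
\<close>

lemma small_hull:
  fixes K :: "'k set"
  assumes AB: "(A, B) \<in> le_formulas R ar sat S" and X: "X \<subseteq> carrier B"
    and K: "infinite K" and RK: "|carrier R| \<le>o |K|" and SK: "|S| \<le>o |K|"
    and ixK: "\<And>\<phi>. \<phi> \<in> S \<Longrightarrow> |ix \<phi>| \<le>o |K|"
  obtains N where "X \<subseteq> N" "submodule_of R B N" "|N| \<le>o |X| +c |K|"
    "(restrict_module R B (sum_of_sets B N (carrier A)), B) \<in> le_formulas R ar sat S"
proof -
  have B: "B \<in> RMod R" using AB unfolding le_formulas_def by auto
  interpret B: abelian_group B using B by (rule RMod_abelian_group)
  define good where "good \<phi> xs v \<longleftrightarrow> v \<in> ix \<phi> \<rightarrow> carrier B \<and>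
    (\<exists>a \<in> {..<ar \<phi>} \<rightarrow> carrier A. sol B \<phi> (\<lambda>j. xs ! j \<oplus>\<^bsub>B\<^esub> a j) v)" for \<phi> and xs :: "'u list" and v
  define wit where "wit \<phi> xs = (SOME v. good \<phi> xs v)" for \<phi> xs
  define W where "W \<phi> xs = (if \<exists>v. good \<phi> xs v then wit \<phi> xs ` ix \<phi> else {})" for \<phi> xs
  define F where "F xs = {\<zero>\<^bsub>B\<^esub>} \<union> (if length xs = 2 then {xs ! 0 \<ominus>\<^bsub>B\<^esub> xs ! 1} else {})
    \<union> (if length xs = 1 then (\<lambda>r. r \<odot>\<^bsub>B\<^esub> xs ! 0) ` carrier R else {}) \<union> (\<Union>\<phi>\<in>S. W \<phi> xs)" for xs
  have wit: "good \<phi> xs (wit \<phi> xs)" if "good \<phi> xs v" for \<phi> xs v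
    unfolding wit_def using that by (rule someI[of "good \<phi> xs"])
  have FB: "F xs \<subseteq> carrier B" if xs: "xs \<in> lists (carrier B)" for xs
  proof -
    have "W \<phi> xs \<subseteq> carrier B" for \<phi>
      using wit[of \<phi> xs] unfolding W_def good_def by (auto simp: Pi_iff)
    moreover have nth: "i < length xs \<Longrightarrow> xs ! i \<in> carrier B" for i
      using xs nth_mem by blast
    ultimately show ?thesis
      unfolding F_def using RMod_smult_closed[OF B] nth[of 0] nth[of 1] by (auto split: if_splits)
  qed
  have FK: "|F xs| \<le>o |K|" for xs
  proof -
    have fin: "finite Y \<Longrightarrow> |Y| \<le>o |K|" for Y :: "'u set"
      using K ordLess_imp_ordLeq[OF finite_ordLess_infinite2] by blast
    have "|(\<lambda>r. r \<odot>\<^bsub>B\<^esub> xs ! 0) ` carrier R| \<le>o |K|"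
      using card_of_image RK by (rule ordLeq_transitive)
    moreover have "|W \<phi> xs| \<le>o |K|" if "\<phi> \<in> S" for \<phi>
      using ordLeq_transitive[OF card_of_image[of "wit \<phi> xs"] ixK[OF that]] fin[of "{}"] unfolding W_def by simp
    then have "|\<Union>\<phi>\<in>S. W \<phi> xs| \<le>o |K|"
      by (intro card_of_UNION_ordLeq_infinite[OF K SK] ballI)
    ultimately show ?thesis
      unfolding F_def using K fin by (intro card_of_Un_ordLeq_infinite) auto
  qed
  obtain N where N: "X \<subseteq> N" "N \<subseteq> carrier B" "\<And>xs. xs \<in> lists N \<Longrightarrow> F xs \<subseteq> N" "|N| \<le>o |X| +c |K|"
    by (rule closure_under_operations[OF K X, of F]) (use FB FK in auto)
  have "submodule_of R B N"
    unfolding submodule_of_def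
  proof (intro conjI ballI)
    show "\<zero>\<^bsub>B\<^esub> \<in> N" using N(3)[of "[]"] unfolding F_def by simp
    show "x \<ominus>\<^bsub>B\<^esub> y \<in> N" if "x \<in> N" "y \<in> N" for x y
      using N(3)[of "[x, y]"] that unfolding F_def by simp
    show "r \<odot>\<^bsub>B\<^esub> x \<in> N" if "r \<in> carrier R" "x \<in> N" for r x
      using N(3)[of "[x]"] that unfolding F_def by auto
  qed (fact N(2))
  moreover have "(restrict_module R B (sum_of_sets B N (carrier A)), B) \<in> le_formulas R ar sat S"
  proof (rule sum_elementary[OF AB \<open>submodule_of R B N\<close>])
    fix \<phi> xs a v
    assume \<phi>: "\<phi> \<in> S" and xs: "xs \<in> lists N"
      and "a \<in> {..<ar \<phi>} \<rightarrow> carrier A" "v \<in> ix \<phi> \<rightarrow> carrier B" "sol B \<phi> (\<lambda>j. xs ! j \<oplus>\<^bsub>B\<^esub> a j) v"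
    then have good: "good \<phi> xs v" unfolding good_def by blast
    have "W \<phi> xs \<subseteq> F xs" unfolding F_def using \<phi> by blast
    moreover have "W \<phi> xs = wit \<phi> xs ` ix \<phi>" unfolding W_def by (rule if_P) (rule exI, rule good)
    ultimately have "wit \<phi> xs ` ix \<phi> \<subseteq> N" using N(3)[OF xs] by simp
    then show "\<exists>a' \<in> {..<ar \<phi>} \<rightarrow> carrier A. \<exists>v' \<in> ix \<phi> \<rightarrow> N. sol B \<phi> (\<lambda>j. xs ! j \<oplus>\<^bsub>B\<^esub> a' j) v'"
      using wit[OF good] unfolding good_def by (auto simp: image_subset_iff)
  qed
  ultimately show ?thesis using that N by blast
qed

lemma small_hull_point:
  fixes K :: "'k set"
  assumes AB: "(A, B) \<in> le_formulas R ar sat S" and b: "b \<in> carrier B"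
    and K: "infinite K" "|carrier R| \<le>o |K|" "|S| \<le>o |K|" "\<And>\<phi>. \<phi> \<in> S \<Longrightarrow> |ix \<phi>| \<le>o |K|"
  shows "\<exists>N. b \<in> N \<and> submodule_of R B N \<and> |N| \<le>o |K| \<and>
    (restrict_module R B (sum_of_sets B N (carrier A)), B) \<in> le_formulas R ar sat S"
proof -
  have "{b} \<subseteq> carrier B" using b by simp
  then obtain N where N: "{b} \<subseteq> N" "submodule_of R B N" "|N| \<le>o |{b}| +c |K|"
    "(restrict_module R B (sum_of_sets B N (carrier A)), B) \<in> le_formulas R ar sat S"
    by (rule small_hull[OF AB _ K])
  have "|{b}| \<le>o |K|" using K(1) by (intro ordLess_imp_ordLeq finite_ordLess_infinite2) simp_all
  then have "|{b}| +c |K| =o |K|"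
    using K(1) by (intro csum_absorb2) (simp_all add: cinfinite_def Field_card_of card_of_Card_order)
  then have "|N| \<le>o |K|" using N(3) ordLeq_ordIso_trans by blast
  with N show ?thesis by (intro exI[of _ N]) simp
qed

lemma LS_bound_le_formulas:
  fixes K :: "'k set"
  assumes summand: "\<And>A B. direct_summand R A B \<Longrightarrow> (A, B) \<in> le_formulas R ar sat S"
    and K: "infinite K" "|carrier R| \<le>o |K|" "|S| \<le>o |K|" "\<And>\<phi>. \<phi> \<in> S \<Longrightarrow> |ix \<phi>| \<le>o |K|"
    and l: "small_cardinal l" "|K| \<le>o l" "|carrier R| +c natLeq \<le>o l"
  shows "LS_bound R (RMod R) (le_formulas R ar sat S) l"
  unfolding LS_bound_def
proof (intro conjI ballI allI impI)
  fix B :: "('r, 'u) module" and X assume B: "B \<in> RMod R" and X: "X \<subseteq> carrier B"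
  interpret B: abelian_group B using B by (rule RMod_abelian_group)
  let ?Z = "restrict_module R B {\<zero>\<^bsub>B\<^esub>}"
  obtain N where N: "X \<subseteq> N" "submodule_of R B N" "|N| \<le>o |X| +c |K|"
    "(restrict_module R B (sum_of_sets B N (carrier ?Z)), B) \<in> le_formulas R ar sat S"
    by (rule small_hull[OF summand[OF zero_direct_summand[OF B]] X K])
  let ?C = "restrict_module R B (sum_of_sets B N (carrier ?Z))"
  have NB: "N \<subseteq> carrier B" using N(2) unfolding submodule_of_def by simp
  then have "sum_of_sets B N (carrier ?Z) = N"
    unfolding sum_of_sets_def by (force simp: subset_iff)
  moreover have "?C \<in> RMod R" using N(4) unfolding le_formulas_def by simp
  moreover have "|N| \<le>o |X| +c l"
    using N(3) csum_mono2[OF l(2)] ordLeq_transitive by blast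
  ultimately show "\<exists>A\<in>RMod R. X \<subseteq> carrier A \<and> (A, B) \<in> le_formulas R ar sat S \<and> |carrier A| \<le>o |X| +c l"
    using N(1,4) by (intro bexI[of _ ?C]) simp_all
qed (fact l)+

end


section \<open>Counting types\<close>

definition combination ::
    "('r, 'u) module \<Rightarrow> ('k \<Rightarrow> 'u) \<Rightarrow> 'r \<times> 'k \<times> 'k \<times> 'k \<Rightarrow> 'u" where
  "combination M e = (\<lambda>(r, i, j, k). (r \<odot>\<^bsub>M\<^esub> e i \<oplus>\<^bsub>M\<^esub> e j) \<ominus>\<^bsub>M\<^esub> e k)"

text \<open>
  Agreement of the data that determine \<open>e1 ` K + Y\<close> and \<open>e2 ` K + Y\<close> over \<open>Y\<close>, for enumerated
  submodules \<open>e1 ` K\<close> and \<open>e2 ` K\<close>. The single shape \<open>r e\<^sub>i + e\<^sub>j - e\<^sub>k\<close> covers addition (\<open>r = 1\<close>), congruence modulo \<open>Y\<close> (\<open>r = 0\<close>) and, when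
  \<open>e\<^sub>j = 0\<close>, multiplication by \<open>r\<close>.
\<close>

definition same_combinations ::
    "('r, 'm) ring_scheme \<Rightarrow> 'u set \<Rightarrow> 'k set \<Rightarrow> ('r, 'u) module \<Rightarrow> ('k \<Rightarrow> 'u) \<Rightarrow>
     ('r, 'u) module \<Rightarrow> ('k \<Rightarrow> 'u) \<Rightarrow> bool" where
  "same_combinations R Y K B1 e1 B2 e2 \<longleftrightarrow>
     (\<forall>d \<in> carrier R \<times> K \<times> K \<times> K. \<forall>y\<in>Y. combination B1 e1 d = y \<longleftrightarrow> combination B2 e2 d = y)"

lemma same_combinationsD:
  assumes "same_combinations R Y K B1 e1 B2 e2" "r \<in> carrier R" "i \<in> K" "j \<in> K" "k \<in> K" "y \<in> Y"
    and "(r \<odot>\<^bsub>B1\<^esub> e1 i \<oplus>\<^bsub>B1\<^esub> e1 j) \<ominus>\<^bsub>B1\<^esub> e1 k = y"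
  shows "(r \<odot>\<^bsub>B2\<^esub> e2 i \<oplus>\<^bsub>B2\<^esub> e2 j) \<ominus>\<^bsub>B2\<^esub> e2 k = y"
proof -
  have "(r, i, j, k) \<in> carrier R \<times> K \<times> K \<times> K" using assms by simp
  then have "combination B1 e1 (r, i, j, k) = y \<longleftrightarrow> combination B2 e2 (r, i, j, k) = y"
    using assms(1,6) unfolding same_combinations_def by blast
  then show ?thesis using assms(7) unfolding combination_def by simp
qed

lemma same_combinations_sym:
  "same_combinations R Y K B1 e1 B2 e2 \<Longrightarrow> same_combinations R Y K B2 e2 B1 e1"
  unfolding same_combinations_def by blast

lemma same_combinations_transfer:
  assumes A: "A \<in> RMod R" and B1: "B1 \<in> RMod R" "substructure R A B1"
    and B2: "B2 \<in> RMod R" "substructure R A B2"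
    and e1: "e1 ` K \<subseteq> carrier B1" and e2: "e2 ` K \<subseteq> carrier B2"
    and same: "same_combinations R (carrier A) K B1 e1 B2 e2"
    and z: "z \<in> K" "e1 z = \<zero>\<^bsub>B1\<^esub>" and ijk: "i \<in> K" "j \<in> K" "k \<in> K"
  shows "e2 z = \<zero>\<^bsub>B2\<^esub>"
    and "a \<in> carrier A \<Longrightarrow> b \<in> carrier A \<Longrightarrow> e1 i \<oplus>\<^bsub>B1\<^esub> a = e1 j \<oplus>\<^bsub>B1\<^esub> b \<Longrightarrow> e2 i \<oplus>\<^bsub>B2\<^esub> a = e2 j \<oplus>\<^bsub>B2\<^esub> b"
    and "e1 i \<oplus>\<^bsub>B1\<^esub> e1 j = e1 k \<Longrightarrow> e2 i \<oplus>\<^bsub>B2\<^esub> e2 j = e2 k"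
    and "r \<in> carrier R \<Longrightarrow> r \<odot>\<^bsub>B1\<^esub> e1 i = e1 k \<Longrightarrow> r \<odot>\<^bsub>B2\<^esub> e2 i = e2 k"
proof -
  interpret R: ring R using A by (rule RMod_ring)
  interpret A: abelian_group A using A by (rule RMod_abelian_group)
  interpret B1: abelian_group B1 using B1(1) by (rule RMod_abelian_group)
  interpret B2: abelian_group B2 using B2(1) by (rule RMod_abelian_group)
  note sub1 = substructure_simps[OF B1(2)] and sub2 = substructure_simps[OF B2(2)]
  have e1_c: "e1 m \<in> carrier B1" and e2_c: "e2 m \<in> carrier B2" if "m \<in> K" for m
    using that e1 e2 by auto
  note ijk_c = e1_c[OF ijk(1)] e1_c[OF ijk(2)] e1_c[OF ijk(3)] e2_c[OF ijk(1)] e2_c[OF ijk(2)] e2_c[OF ijk(3)]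
  note S = same_combinationsD[OF same]
  have zero_A: "\<zero>\<^bsub>B1\<^esub> \<in> carrier A" "\<zero>\<^bsub>B1\<^esub> = \<zero>\<^bsub>B2\<^esub>"
    using A.zero_closed sub1(2) sub2(2) by auto
  note zero_smult = RMod_zero_smult[OF B1(1)] RMod_zero_smult[OF B2(1)]
  note one_smult = RMod_one_smult[OF B1(1)] RMod_one_smult[OF B2(1)]
  show "e2 i \<oplus>\<^bsub>B2\<^esub> a = e2 j \<oplus>\<^bsub>B2\<^esub> b"
    if ab: "a \<in> carrier A" "b \<in> carrier A" and eq: "e1 i \<oplus>\<^bsub>B1\<^esub> a = e1 j \<oplus>\<^bsub>B1\<^esub> b"
  proof -
    have ab1: "a \<in> carrier B1" "b \<in> carrier B1" and ab2: "a \<in> carrier B2" "b \<in> carrier B2"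
      using ab sub1(1) sub2(1) by auto
    have "e1 i \<ominus>\<^bsub>B1\<^esub> e1 j = b \<ominus>\<^bsub>A\<^esub> a"
      using eq ijk_c B1.add_eq_add_iff_diff[OF _ ab1(1) _ ab1(2)] substructure_a_minus[OF A B1 ab(2,1)] by simp
    then have "(\<zero>\<^bsub>R\<^esub> \<odot>\<^bsub>B1\<^esub> e1 i \<oplus>\<^bsub>B1\<^esub> e1 i) \<ominus>\<^bsub>B1\<^esub> e1 j = b \<ominus>\<^bsub>A\<^esub> a"
      using ijk_c by (simp add: zero_smult)
    then have "(\<zero>\<^bsub>R\<^esub> \<odot>\<^bsub>B2\<^esub> e2 i \<oplus>\<^bsub>B2\<^esub> e2 i) \<ominus>\<^bsub>B2\<^esub> e2 j = b \<ominus>\<^bsub>A\<^esub> a"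
      using S[of "\<zero>\<^bsub>R\<^esub>" i i j "b \<ominus>\<^bsub>A\<^esub> a"] ijk ab by simp
    then have "e2 i \<ominus>\<^bsub>B2\<^esub> e2 j = b \<ominus>\<^bsub>B2\<^esub> a"
      using ijk_c ab substructure_a_minus[OF A B2] by (simp add: zero_smult)
    then show ?thesis using ijk_c B2.add_eq_add_iff_diff[OF _ ab2(1) _ ab2(2)] by simp
  qed
  show "e2 i \<oplus>\<^bsub>B2\<^esub> e2 j = e2 k" if "e1 i \<oplus>\<^bsub>B1\<^esub> e1 j = e1 k"
  proof -
    have "(\<one>\<^bsub>R\<^esub> \<odot>\<^bsub>B1\<^esub> e1 i \<oplus>\<^bsub>B1\<^esub> e1 j) \<ominus>\<^bsub>B1\<^esub> e1 k = \<zero>\<^bsub>B1\<^esub>"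
      using that ijk_c by (simp add: one_smult B1.diff_eq_zero_iff)
    from S[OF _ ijk zero_A(1) this] show ?thesis
      using ijk_c zero_A(2) by (simp add: one_smult B2.diff_eq_zero_iff)
  qed
  \<comment> \<open>Both enumerations have \<open>0\<close> at the same index, because \<open>1x + x - x = x\<close>.\<close>
  have "(\<one>\<^bsub>R\<^esub> \<odot>\<^bsub>B1\<^esub> e1 z \<oplus>\<^bsub>B1\<^esub> e1 z) \<ominus>\<^bsub>B1\<^esub> e1 z = \<zero>\<^bsub>B1\<^esub>"
    using z(2) one_smult(1)[of "e1 z"] by (simp add: a_minus_def)
  from S[OF R.one_closed z(1) z(1) z(1) zero_A(1) this]
  have "(e2 z \<oplus>\<^bsub>B2\<^esub> e2 z) \<ominus>\<^bsub>B2\<^esub> e2 z = \<zero>\<^bsub>B2\<^esub>"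
    using e2_c[OF z(1)] zero_A(2) by (simp add: one_smult)
  then show z2: "e2 z = \<zero>\<^bsub>B2\<^esub>"
    using e2_c[OF z(1)] by (simp add: a_minus_def B2.a_assoc B2.r_neg)
  show "r \<odot>\<^bsub>B2\<^esub> e2 i = e2 k" if r: "r \<in> carrier R" and eq: "r \<odot>\<^bsub>B1\<^esub> e1 i = e1 k"
  proof -
    have "(r \<odot>\<^bsub>B1\<^esub> e1 i \<oplus>\<^bsub>B1\<^esub> e1 z) \<ominus>\<^bsub>B1\<^esub> e1 k = \<zero>\<^bsub>B1\<^esub>"
      using eq z(2) ijk_c by (simp add: B1.diff_eq_zero_iff)
    from S[OF r ijk(1) z(1) ijk(3) zero_A(1) this] show ?thesis
      using ijk_c z2 zero_A(2) RMod_smult_closed[OF B2(1) r] by (simp add: B2.diff_eq_zero_iff)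
  qed
qed

text \<open>
  The isomorphism sends \<open>e1 k + a\<close> to \<open>e2 k + a\<close>. It is well defined and injective because
  \<open>e1 i + a = e1 j + b\<close> says that the combination \<open>e1 i - e1 j\<close> lies in \<open>A\<close> with value \<open>b - a\<close>, and
  every combination takes the same values in \<open>A\<close> on both sides.
\<close>

lemma sum_isomorphism:
  assumes A: "A \<in> RMod R" and B1: "B1 \<in> RMod R" "substructure R A B1"
    and B2: "B2 \<in> RMod R" "substructure R A B2"
    and N1: "submodule_of R B1 (e1 ` K)" and N2: "submodule_of R B2 (e2 ` K)"
    and same: "same_combinations R (carrier A) K B1 e1 B2 e2"
  defines "M1 \<equiv> restrict_module R B1 (sum_of_sets B1 (e1 ` K) (carrier A))"
    and "M2 \<equiv> restrict_module R B2 (sum_of_sets B2 (e2 ` K) (carrier A))"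
  obtains g where "g \<in> mod_hom R M1 M2" "inj_on g (carrier M1)" "g ` carrier M1 = carrier M2"
    "\<And>a. a \<in> carrier A \<Longrightarrow> g a = a" "\<And>k. k \<in> K \<Longrightarrow> g (e1 k) = e2 k"
proof -
  interpret A: abelian_group A using A by (rule RMod_abelian_group)
  interpret B1: abelian_group B1 using B1(1) by (rule RMod_abelian_group)
  interpret B2: abelian_group B2 using B2(1) by (rule RMod_abelian_group)
  note sub1 = substructure_simps[OF B1(2)] and sub2 = substructure_simps[OF B2(2)]
  have c1: "e1 ` K \<subseteq> carrier B1" and c2: "e2 ` K \<subseteq> carrier B2"
    using N1 N2 unfolding submodule_of_def by auto
  have e1_c: "e1 m \<in> carrier B1" and e2_c: "e2 m \<in> carrier B2" if "m \<in> K" for m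
    using that c1 c2 by auto
  obtain z where z: "z \<in> K" "e1 z = \<zero>\<^bsub>B1\<^esub>"
    using N1 unfolding submodule_of_def by auto
  note T = same_combinations_transfer[OF A B1 B2 c1 c2 same z]
  have z2: "e2 z = \<zero>\<^bsub>B2\<^esub>" by (rule T(1)[OF z(1) z(1) z(1)])
  note T' = same_combinations_transfer[OF A B2 B1 c2 c1 same_combinations_sym[OF same] z(1) z2]
  define P where "P x k a \<longleftrightarrow> k \<in> K \<and> a \<in> carrier A \<and> x = e1 k \<oplus>\<^bsub>B1\<^esub> a" for x k a
  define g where "g x = (SOME y. \<exists>k a. P x k a \<and> y = e2 k \<oplus>\<^bsub>B2\<^esub> a)" for x
  have g: "g (e1 k \<oplus>\<^bsub>B1\<^esub> a) = e2 k \<oplus>\<^bsub>B2\<^esub> a" if "k \<in> K" "a \<in> carrier A" for k a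
  proof -
    have "\<exists>y k' a'. P (e1 k \<oplus>\<^bsub>B1\<^esub> a) k' a' \<and> y = e2 k' \<oplus>\<^bsub>B2\<^esub> a'"
      using that unfolding P_def by blast
    then have "\<exists>k' a'. P (e1 k \<oplus>\<^bsub>B1\<^esub> a) k' a' \<and> g (e1 k \<oplus>\<^bsub>B1\<^esub> a) = e2 k' \<oplus>\<^bsub>B2\<^esub> a'"
      unfolding g_def by (rule someI_ex)
    then show ?thesis using T(2) that unfolding P_def by metis
  qed
  have carrier_M1: "carrier M1 = {e1 k \<oplus>\<^bsub>B1\<^esub> a | k a. k \<in> K \<and> a \<in> carrier A}"
    and carrier_M2: "carrier M2 = {e2 k \<oplus>\<^bsub>B2\<^esub> a | k a. k \<in> K \<and> a \<in> carrier A}"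
    unfolding M1_def M2_def sum_of_sets_def by auto
  have gM: "g x \<in> carrier M2" if "x \<in> carrier M1" for x
    using that g unfolding carrier_M1 carrier_M2 by auto
  have add: "g (x \<oplus>\<^bsub>M1\<^esub> y) = g x \<oplus>\<^bsub>M2\<^esub> g y" if xy: "x \<in> carrier M1" "y \<in> carrier M1" for x y
  proof -
    obtain i a j b where x: "i \<in> K" "a \<in> carrier A" "x = e1 i \<oplus>\<^bsub>B1\<^esub> a"
      and y: "j \<in> K" "b \<in> carrier A" "y = e1 j \<oplus>\<^bsub>B1\<^esub> b"
      using xy unfolding carrier_M1 by auto
    obtain k where k: "k \<in> K" "e1 i \<oplus>\<^bsub>B1\<^esub> e1 j = e1 k"
      using submodule_of_add[OF B1.abelian_group_axioms N1, of "e1 i" "e1 j"] x(1) y(1) by auto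
    have k2: "e2 i \<oplus>\<^bsub>B2\<^esub> e2 j = e2 k" by (rule T(3)[OF x(1) y(1) k])
    have "x \<oplus>\<^bsub>M1\<^esub> y = (e1 i \<oplus>\<^bsub>B1\<^esub> a) \<oplus>\<^bsub>B1\<^esub> (e1 j \<oplus>\<^bsub>B1\<^esub> b)"
      using xy x y unfolding M1_def by simp
    also have "\<dots> = (e1 i \<oplus>\<^bsub>B1\<^esub> e1 j) \<oplus>\<^bsub>B1\<^esub> (a \<oplus>\<^bsub>B1\<^esub> b)"
      using x y sub1(1) e1_c by (simp add: B1.a_ac)
    also have "\<dots> = e1 k \<oplus>\<^bsub>B1\<^esub> (a \<oplus>\<^bsub>A\<^esub> b)"
      using k(2) sub1(3) x y by simp
    finally have "g (x \<oplus>\<^bsub>M1\<^esub> y) = e2 k \<oplus>\<^bsub>B2\<^esub> (a \<oplus>\<^bsub>A\<^esub> b)" using g[OF k(1)] x y by simp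
    also have "\<dots> = (e2 i \<oplus>\<^bsub>B2\<^esub> e2 j) \<oplus>\<^bsub>B2\<^esub> (a \<oplus>\<^bsub>B2\<^esub> b)"
      using k2 sub2(3) x y by simp
    also have "\<dots> = (e2 i \<oplus>\<^bsub>B2\<^esub> a) \<oplus>\<^bsub>B2\<^esub> (e2 j \<oplus>\<^bsub>B2\<^esub> b)"
      using x y sub2(1) e2_c by (simp add: B2.a_ac)
    also have "\<dots> = g x \<oplus>\<^bsub>B2\<^esub> g y" using g x y by simp
    also have "\<dots> = g x \<oplus>\<^bsub>M2\<^esub> g y" using gM[OF xy(1)] gM[OF xy(2)] unfolding M2_def by simp
    finally show ?thesis .
  qed
  have smult: "g (r \<odot>\<^bsub>M1\<^esub> x) = r \<odot>\<^bsub>M2\<^esub> g x" if r: "r \<in> carrier R" and xM: "x \<in> carrier M1" for r x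
  proof -
    obtain i a where x: "i \<in> K" "a \<in> carrier A" "x = e1 i \<oplus>\<^bsub>B1\<^esub> a"
      using xM unfolding carrier_M1 by auto
    obtain k where k: "k \<in> K" "r \<odot>\<^bsub>B1\<^esub> e1 i = e1 k"
      using N1 r x(1) unfolding submodule_of_def by (metis imageE imageI)
    have k2: "r \<odot>\<^bsub>B2\<^esub> e2 i = e2 k" by (rule T(4)[OF x(1) x(1) k(1) r k(2)])
    have "r \<odot>\<^bsub>M1\<^esub> x = r \<odot>\<^bsub>B1\<^esub> e1 i \<oplus>\<^bsub>B1\<^esub> r \<odot>\<^bsub>B1\<^esub> a"
      using r xM x sub1(1) e1_c RMod_smult_add[OF B1(1)] unfolding M1_def by simp
    also have "\<dots> = e1 k \<oplus>\<^bsub>B1\<^esub> (r \<odot>\<^bsub>A\<^esub> a)" using k(2) sub1(4) r x by simp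
    finally have "g (r \<odot>\<^bsub>M1\<^esub> x) = e2 k \<oplus>\<^bsub>B2\<^esub> (r \<odot>\<^bsub>A\<^esub> a)"
      using g[OF k(1)] RMod_smult_closed[OF A r x(2)] by simp
    also have "\<dots> = r \<odot>\<^bsub>B2\<^esub> (e2 i \<oplus>\<^bsub>B2\<^esub> a)"
      using k2 sub2(1,4) r x e2_c RMod_smult_add[OF B2(1)] by simp
    also have "\<dots> = r \<odot>\<^bsub>M2\<^esub> g x" using g x r gM[OF xM] unfolding M2_def by simp
    finally show ?thesis .
  qed
  show ?thesis
  proof
    show "g \<in> mod_hom R M1 M2" unfolding mod_hom_def using gM add smult by auto
    show "inj_on g (carrier M1)"
    proof (rule inj_onI)
      fix x y assume "x \<in> carrier M1" "y \<in> carrier M1" and eq: "g x = g y"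
      then obtain i a j b where x: "i \<in> K" "a \<in> carrier A" "x = e1 i \<oplus>\<^bsub>B1\<^esub> a"
        and y: "j \<in> K" "b \<in> carrier A" "y = e1 j \<oplus>\<^bsub>B1\<^esub> b"
        unfolding carrier_M1 by auto
      have "e2 i \<oplus>\<^bsub>B2\<^esub> a = e2 j \<oplus>\<^bsub>B2\<^esub> b" using eq g x y by simp
      then show "x = y" using T'(2)[OF x(1) y(1) x(1) x(2) y(2)] x(3) y(3) by simp
    qed
    have "carrier M2 \<subseteq> g ` carrier M1"
    proof
      fix y assume "y \<in> carrier M2"
      then obtain k a where k: "k \<in> K" "a \<in> carrier A" "y = e2 k \<oplus>\<^bsub>B2\<^esub> a" unfolding carrier_M2 by auto
      then have "y = g (e1 k \<oplus>\<^bsub>B1\<^esub> a)" using g by simp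
      then show "y \<in> g ` carrier M1" using k unfolding carrier_M1 by blast
    qed
    then show "g ` carrier M1 = carrier M2" using gM by blast
    show "g a = a" if "a \<in> carrier A" for a
      using g[OF z(1) that] z(2) z2 sub1(1) sub2(1) that by simp
    show "g (e1 k) = e2 k" if "k \<in> K" for k
      using g[OF that A.zero_closed] sub1(2) sub2(2) e1_c[OF that] e2_c[OF that]
      by (metis B1.r_zero B2.r_zero)
  qed
qed

text \<open>
  \<open>E_at\<close> is symmetric, so the image of a triple under its transitive closure is the full
  equivalence class.
\<close>

lemma gtp_cong:
  assumes "(p, q) \<in> (E_at R C prec)\<^sup>+" "p = (b, X, A)" "q = (b', X', A')"
  shows "gtp R C prec b X A = gtp R C prec b' X' A'"
proof -
  have "sym (E_at R C prec)"
    unfolding E_at_def by (rule symI) (clarsimp, metis)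
  then have "(q, p) \<in> (E_at R C prec)\<^sup>+" using assms(1) sym_trancl symD by metis
  then show ?thesis
    using assms unfolding gtp_def by (auto intro: trancl_trans)
qed

text \<open>
  Types do not change when the ambient module is replaced by a strong submodule: \<open>B\<close> itself receives
  both, by the identity.
\<close>

lemma E_at_submodel:
  assumes K: "AEC R (RMod R) prec" and MB: "(M, B) \<in> prec"
    and X: "X \<subseteq> carrier M" and b: "range b \<subseteq> carrier M"
  shows "((b, X, M), (b, X, B)) \<in> E_at R (RMod R) prec"
proof -
  have po: "partial_order_on (RMod R) prec" and "substructure R M B"
    using K MB unfolding AEC_def by blast+
  then have M: "M \<in> RMod R" and B: "B \<in> RMod R" and BB: "(B, B) \<in> prec"
    using MB unfolding partial_order_on_def preorder_on_def refl_on_def by blast+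
  note sub = substructure_simps[OF \<open>substructure R M B\<close>]
  have "id \<in> strong_embedding R prec M B"
    using MB \<open>substructure R M B\<close> sub unfolding strong_embedding_def mod_hom_def substructure_def by auto
  moreover have "id \<in> strong_embedding R prec B B"
    using BB restrict_module_carrier[OF B] unfolding strong_embedding_def mod_hom_def by auto
  ultimately have "\<exists>C\<in>RMod R. \<exists>f1\<in>strong_embedding R prec M C. \<exists>f2\<in>strong_embedding R prec B C.
      (\<forall>x\<in>X. f1 x = x \<and> f2 x = x) \<and> f1 \<circ> b = f2 \<circ> b"
    using B by (intro bexI[of _ B] bexI[of _ id]) simp_all
  moreover have "X \<subseteq> carrier B" "range b \<subseteq> carrier B" using X b sub(1) by auto
  ultimately show ?thesis unfolding E_at_def using M B X b by simp
qed

text \<open>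
  The chain \<open>B1\<close>, \<open>e1 ` K + A\<close>, \<open>e2 ` K + A\<close>, \<open>B2\<close> of \<open>E_at\<close>-steps: two inclusions and one
  isomorphism. Types are classes of the transitive closure of \<open>E_at\<close>, so they may be compared along
  such a chain; no common extension of \<open>B1\<close> and \<open>B2\<close> over \<open>A\<close> is constructed.
\<close>

lemma gtp_eqI:
  assumes K: "AEC R (RMod R) prec" and B1: "(A, B1) \<in> prec" and B2: "(A, B2) \<in> prec"
    and N1: "submodule_of R B1 (e1 ` K)" and N2: "submodule_of R B2 (e2 ` K)"
    and M1: "(restrict_module R B1 (sum_of_sets B1 (e1 ` K) (carrier A)), B1) \<in> prec"
    and M2: "(restrict_module R B2 (sum_of_sets B2 (e2 ` K) (carrier A)), B2) \<in> prec"
    and same: "same_combinations R (carrier A) K B1 e1 B2 e2" and k: "k \<in> K"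
  shows "gtp R (RMod R) prec (\<lambda>_ :: 'i. e1 k) (carrier A) B1 = gtp R (RMod R) prec (\<lambda>_ :: 'i. e2 k) (carrier A) B2"
proof -
  let ?M1 = "restrict_module R B1 (sum_of_sets B1 (e1 ` K) (carrier A))"
  let ?M2 = "restrict_module R B2 (sum_of_sets B2 (e2 ` K) (carrier A))"
  have refl: "refl_on (RMod R) prec" and fld: "prec \<subseteq> RMod R \<times> RMod R"
    using K unfolding AEC_def partial_order_on_def preorder_on_def by auto
  have prec_sub: "substructure R A' B'" if "(A', B') \<in> prec" for A' B'
    using K that unfolding AEC_def by blast
  have RM: "A \<in> RMod R" "B1 \<in> RMod R" "B2 \<in> RMod R" "?M1 \<in> RMod R" "?M2 \<in> RMod R"
    using fld B1 B2 M1 M2 by auto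
  note A1 = prec_sub[OF B1] and A2 = prec_sub[OF B2]
  note T1 = submodule_of_sum[OF RM(2) N1 substructure_submodule_of[OF RM(1,2) A1]]
    and T2 = submodule_of_sum[OF RM(3) N2 substructure_submodule_of[OF RM(1,3) A2]]
  obtain g where g: "g \<in> mod_hom R ?M1 ?M2" "inj_on g (carrier ?M1)" "g ` carrier ?M1 = carrier ?M2"
    and gA: "\<And>a. a \<in> carrier A \<Longrightarrow> g a = a" and ge: "\<And>k. k \<in> K \<Longrightarrow> g (e1 k) = e2 k"
    using sum_isomorphism[OF RM(1,2) A1 RM(3) A2 N1 N2 same] by blast
  have refl2: "(?M2, ?M2) \<in> prec" using refl RM(5) unfolding refl_on_def by blast
  have "g \<in> strong_embedding R prec ?M1 ?M2"
    using g refl2 restrict_module_carrier[OF RM(5)] unfolding strong_embedding_def by simp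
  moreover have "id \<in> strong_embedding R prec ?M2 ?M2"
    using refl2 restrict_module_carrier[OF RM(5)] unfolding strong_embedding_def mod_hom_def by auto
  moreover have "g \<circ> (\<lambda>_ :: 'i. e1 k) = id \<circ> (\<lambda>_ :: 'i. e2 k)" using ge[OF k] by auto
  ultimately have "\<exists>C\<in>RMod R. \<exists>f1\<in>strong_embedding R prec ?M1 C. \<exists>f2\<in>strong_embedding R prec ?M2 C.
      (\<forall>x\<in>carrier A. f1 x = x \<and> f2 x = x) \<and> f1 \<circ> (\<lambda>_ :: 'i. e1 k) = f2 \<circ> (\<lambda>_ :: 'i. e2 k)"
    using RM(5) gA by (intro bexI[of _ ?M2] bexI[of _ g] bexI[of _ id]) simp_all
  moreover have in1: "carrier A \<subseteq> carrier ?M1" "e1 k \<in> carrier ?M1"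
    and in2: "carrier A \<subseteq> carrier ?M2" "e2 k \<in> carrier ?M2"
    using T1 T2 k by auto
  ultimately have mid: "((\<lambda>_ :: 'i. e1 k, carrier A, ?M1), (\<lambda>_ :: 'i. e2 k, carrier A, ?M2)) \<in> E_at R (RMod R) prec"
    unfolding E_at_def using RM by (auto simp del: restrict_module_simps)
  have "gtp R (RMod R) prec (\<lambda>_ :: 'i. e1 k) (carrier A) ?M1 = gtp R (RMod R) prec (\<lambda>_ :: 'i. e1 k) (carrier A) B1"
    by (rule gtp_cong[OF r_into_trancl[OF E_at_submodel[OF K M1 in1(1)]] HOL.refl HOL.refl]) (use in1 in auto)
  moreover have "gtp R (RMod R) prec (\<lambda>_ :: 'i. e2 k) (carrier A) ?M2 = gtp R (RMod R) prec (\<lambda>_ :: 'i. e2 k) (carrier A) B2"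
    by (rule gtp_cong[OF r_into_trancl[OF E_at_submodel[OF K M2 in2(1)]] HOL.refl HOL.refl]) (use in2 in auto)
  moreover have "gtp R (RMod R) prec (\<lambda>_ :: 'i. e1 k) (carrier A) ?M1 = gtp R (RMod R) prec (\<lambda>_ :: 'i. e2 k) (carrier A) ?M2"
    by (rule gtp_cong[OF r_into_trancl[OF mid] HOL.refl HOL.refl])
  ultimately show ?thesis by simp
qed

text \<open>
  The default value \<open>u\<close> is used with \<open>u \<notin> Y\<close> and then records that a combination lies outside \<open>Y\<close>.
  Outside the index set the value is \<open>undefined\<close>, as membership in \<open>Func\<close> requires.
\<close>

definition code_function ::
    "('r, 'm) ring_scheme \<Rightarrow> 'u set \<Rightarrow> 'k set \<Rightarrow> 'u \<Rightarrow> ('r, 'u) module \<Rightarrow> ('k \<Rightarrow> 'u) \<Rightarrow>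
     'r \<times> 'k \<times> 'k \<times> 'k \<Rightarrow> 'u" where
  "code_function R Y K u B e = (\<lambda>d. if d \<in> carrier R \<times> K \<times> K \<times> K
     then (if combination B e d \<in> Y then combination B e d else u) else undefined)"

lemma code_function_in_Func:
  "code_function R Y K u B e \<in> Func (carrier R \<times> K \<times> K \<times> K) (insert u Y)"
  unfolding code_function_def Func_def by auto

lemma code_function_eqD:
  assumes eq: "code_function R Y K u B1 e1 = code_function R Y K u B2 e2" and u: "u \<notin> Y"
  shows "same_combinations R Y K B1 e1 B2 e2"
  unfolding same_combinations_def
proof (intro ballI)
  fix d y assume "d \<in> carrier R \<times> K \<times> K \<times> K" "y \<in> Y"
  then have "combination B e d = y \<longleftrightarrow> code_function R Y K u B e d = y" for B and e :: "'b \<Rightarrow> 'c"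
    using u unfolding code_function_def by auto
  then show "combination B1 e1 d = y \<longleftrightarrow> combination B2 e2 d = y" using eq by simp
qed

text \<open>
  Fixing the index of the realised element lets the code of a hull determine the type, without a
  further component that points to this element.
\<close>

lemma surjection_with_value:
  assumes "|N| \<le>o |K|" "b \<in> N" "k \<in> K"
  obtains e where "e ` K = N" "e k = b"
proof -
  obtain f where f: "f ` K = N" using assms card_of_ordLeq2[of N K] by blast
  then obtain m where m: "m \<in> K" "f m = b" using assms(2) by blast
  define e where "e = f(m := f k, k := b)"
  have "e ` K = N"
  proof
    show "e ` K \<subseteq> N" unfolding e_def using f assms(2,3) by auto
    show "N \<subseteq> e ` K"
    proof
      fix x assume "x \<in> N"
      then obtain j where j: "j \<in> K" "f j = x" using f by blast
      have "x = e (if j = m then k else if j = k then m else j)"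
        unfolding e_def using j m by auto
      then show "x \<in> e ` K" using j(1) m(1) assms(3) by (metis imageI)
    qed
  qed
  then show ?thesis using that[of e] unfolding e_def by simp
qed

lemma card_types_over_le:
  fixes K :: "'k set" and A :: "('r, 'u) module"
  assumes aec: "AEC R (RMod R) prec" and A: "A \<in> RMod R" and K: "K \<noteq> {}" and u: "u \<notin> carrier A"
    and hull: "\<And>B b. (A, B) \<in> prec \<Longrightarrow> b \<in> carrier B \<Longrightarrow> \<exists>N. b \<in> N \<and> submodule_of R B N \<and> |N| \<le>o |K| \<and>
      (restrict_module R B (sum_of_sets B N (carrier A)), B) \<in> prec"
  shows "|types_over R (RMod R) prec A| \<le>o |Func (carrier R \<times> K \<times> K \<times> K) (insert u (carrier A))|"
proof -
  obtain k where k: "k \<in> K" using K by blast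
  define P where "P p B e \<longleftrightarrow> p = gtp R (RMod R) prec (\<lambda>_. e k) (carrier A) B \<and> (A, B) \<in> prec \<and>
    submodule_of R B (e ` K) \<and> (restrict_module R B (sum_of_sets B (e ` K) (carrier A)), B) \<in> prec"
    for p :: "('r, 'u, unit) triple set" and B and e :: "'k \<Rightarrow> 'u"
  have "\<exists>B e. P p B e" if type: "p \<in> types_over R (RMod R) prec A" for p
  proof -
    obtain B b where p: "p = gtp R (RMod R) prec (\<lambda>_. b) (carrier A) B" and B: "(A, B) \<in> prec" "b \<in> carrier B"
      using type unfolding types_over_def by blast
    obtain N where N: "b \<in> N" "submodule_of R B N" "|N| \<le>o |K|"
      "(restrict_module R B (sum_of_sets B N (carrier A)), B) \<in> prec"
      using hull[OF B] by blast
    obtain e where "e ` K = N" "e k = b" by (rule surjection_with_value[OF N(3,1) k])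
    then have "P p B e" unfolding P_def using p B N by simp
    then show ?thesis by blast
  qed
  then have "\<forall>p\<in>types_over R (RMod R) prec A. \<exists>x. P p (fst x) (snd x)" by fastforce
  from bchoice[OF this] obtain h
    where Pp: "\<And>p. p \<in> types_over R (RMod R) prec A \<Longrightarrow> P p (fst (h p)) (snd (h p))" by blast
  let ?c = "\<lambda>p. code_function R (carrier A) K u (fst (h p)) (snd (h p))"
  have "inj_on ?c (types_over R (RMod R) prec A)"
  proof (rule inj_onI)
    fix p q assume p: "p \<in> types_over R (RMod R) prec A" and q: "q \<in> types_over R (RMod R) prec A"
      and eq: "?c p = ?c q"
    have same: "same_combinations R (carrier A) K (fst (h p)) (snd (h p)) (fst (h q)) (snd (h q))"
      using code_function_eqD[OF eq u] by simp
    note hp = Pp[OF p, unfolded P_def] and hq = Pp[OF q, unfolded P_def]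
    have "gtp R (RMod R) prec (\<lambda>_ :: unit. snd (h p) k) (carrier A) (fst (h p))
        = gtp R (RMod R) prec (\<lambda>_ :: unit. snd (h q) k) (carrier A) (fst (h q))"
      by (rule gtp_eqI[OF aec _ _ _ _ _ _ same k]) (simp_all add: hp[THEN conjunct2] hq[THEN conjunct2])
    then show "p = q" by (rule trans[OF hp[THEN conjunct1] trans[OF _ hq[THEN conjunct1, symmetric]]])
  qed
  then show ?thesis
    by (rule card_of_ordLeqI) (rule code_function_in_Func)
qed

lemma stable_inI:
  fixes K :: "'k set" and R :: "('r, 'm) ring_scheme" and prec :: "('r, 'u) module rel"
  assumes aec: "AEC R (RMod R) prec" and K: "infinite K" and RK: "|carrier R| \<le>o |K|"
    and l: "small_cardinal l" "cinfinite l" "l ^c |K| \<le>o l"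
    and LS: "LS_bound R (RMod R) prec l0" "l0 \<le>o l"
    and hull: "\<And>A B b. (A, B) \<in> prec \<Longrightarrow> b \<in> carrier B \<Longrightarrow> \<exists>N. b \<in> N \<and> submodule_of R B N \<and> |N| \<le>o |K| \<and>
      (restrict_module R B (sum_of_sets B N (carrier A)), B) \<in> prec"
  shows "stable_in R (RMod R) prec l"
  unfolding stable_in_def
proof (intro conjI ballI impI)
  show "small_cardinal l" by fact
  have "\<forall>r\<in>Collect (LS_bound R (RMod R) prec). Well_order r"
    unfolding LS_bound_def small_cardinal_def by (auto dest: card_order_on_well_order_on)
  moreover have "Collect (LS_bound R (RMod R) prec) \<noteq> {}" using LS(1) by blast
  ultimately have "\<exists>l1\<in>Collect (LS_bound R (RMod R) prec). \<forall>l'\<in>Collect (LS_bound R (RMod R) prec). l1 \<le>o l'"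
    by (intro exists_minim_Well_order)
  then show "\<exists>l0. LS_number R (RMod R) prec l0 \<and> l0 \<le>o l"
    using LS ordLeq_transitive unfolding LS_number_def by blast
next
  fix A :: "('r, 'u) module" assume A: "A \<in> RMod R" and card_A: "|carrier A| =o l"
  have lC: "Cinfinite l" using l unfolding small_cardinal_def by blast
  have inf_A: "infinite (carrier A)"
    using Cinfinite_cong[OF ordIso_symmetric[OF card_A] lC] unfolding cinfinite_def by (simp add: Field_card_of)
  have "|carrier A| <o |UNIV :: 'u set|" using A unfolding RMod_def by simp
  then have "carrier A \<noteq> UNIV" using not_ordLess_ordIso[of "|UNIV :: 'u set|"] card_of_refl by metis
  then obtain u where u: "u \<notin> carrier A" by blast
  let ?D = "carrier R \<times> K \<times> K \<times> K"
  have "?D \<noteq> {}" using A RMod_ring[OF A] K by (auto dest: ring.ring_simprules(6))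
  have DK: "|?D| \<le>o |K|"
    using K RK by (intro card_of_Times_ordLeq_infinite) (auto simp: card_of_refl ordIso_imp_ordLeq)
  have Y: "|insert u (carrier A)| \<le>o l"
    using infinite_card_of_insert[OF inf_A] card_A ordIso_transitive ordIso_imp_ordLeq by blast
  have "|types_over R (RMod R) prec A| \<le>o |Func ?D (insert u (carrier A))|"
    using K hull by (intro card_types_over_le[OF aec A _ u]) auto
  also have "|Func ?D (insert u (carrier A))| = |insert u (carrier A)| ^c |?D|"
    by (simp add: cexp_def Field_card_of)
  also have "|insert u (carrier A)| ^c |?D| \<le>o l ^c |K|"
    using \<open>?D \<noteq> {}\<close> by (intro cexp_mono'[OF Y DK]) (simp add: Field_card_of)
  also have "l ^c |K| \<le>o l" by fact
  finally show "|types_over R (RMod R) prec A| \<le>o l" .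
qed


section \<open>Positive primitive formulas\<close>

definition pp_sol :: "('r, 'u) module \<Rightarrow> 'r pp_form \<Rightarrow> (nat \<Rightarrow> 'u) \<Rightarrow> (nat \<Rightarrow> 'u) \<Rightarrow> bool" where
  "pp_sol M \<phi> x y \<longleftrightarrow> (\<forall>i<dim_row (fst \<phi>). lincomb M (fst \<phi>) i y = lincomb M (snd \<phi>) i x)"

lemma lincomb_eq_lin: "lincomb M H i y = lin M (\<lambda>j. H $$ (i, j)) {..<dim_col H} y"
  by (simp add: lincomb_def lin_def)

lemma mat_row_in_carrier:
  assumes "elements_mat H \<subseteq> carrier R" "i < dim_row H"
  shows "(\<lambda>j. H $$ (i, j)) \<in> {..<dim_col H} \<rightarrow> carrier R"
  using assms elements_matI[of H "dim_row H" "dim_col H" i] by (auto simp: subset_iff)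

lemma pleasant_set_existential_linear:
  assumes S: "pleasant_set R S"
  shows "existential_linear_formulas R pp_arity (\<lambda>\<phi>. {..<dim_col (fst \<phi>)}) pp_sol pp_sat S"
proof
  fix \<phi> assume \<phi>: "\<phi> \<in> S"
  have dim: "dim_row (snd \<phi>) = dim_row (fst \<phi>)"
    using bspec[OF S[unfolded pleasant_set_def] \<phi>] by (auto simp: case_prod_unfold)
  have el: "elements_mat (fst \<phi>) \<subseteq> carrier R" "elements_mat (snd \<phi>) \<subseteq> carrier R"
    using bspec[OF S[unfolded pleasant_set_def] \<phi>] by (auto simp: case_prod_unfold)
  have H: "(\<lambda>j. fst \<phi> $$ (i, j)) \<in> {..<dim_col (fst \<phi>)} \<rightarrow> carrier R" if "i < dim_row (fst \<phi>)" for i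
    using mat_row_in_carrier[OF el(1) that] .
  have K: "(\<lambda>j. snd \<phi> $$ (i, j)) \<in> {..<dim_col (snd \<phi>)} \<rightarrow> carrier R" if "i < dim_row (fst \<phi>)" for i
    using mat_row_in_carrier[OF el(2)] that dim by simp
  note defs = pp_sol_def lincomb_eq_lin pp_arity_def
  {
    fix M x assume "M \<in> RMod R" and x: "x \<in> {..<pp_arity \<phi>} \<rightarrow> carrier M"
    show "pp_sat M \<phi> x \<longleftrightarrow> (\<exists>v \<in> {..<dim_col (fst \<phi>)} \<rightarrow> carrier M. pp_sol M \<phi> x v)"
      unfolding pp_sat_def pp_sol_def ..
  next
    fix A B x v
    assume AB: "A \<in> RMod R" "B \<in> RMod R" "substructure R A B"
      and x: "x \<in> {..<pp_arity \<phi>} \<rightarrow> carrier A" and v: "v \<in> {..<dim_col (fst \<phi>)} \<rightarrow> carrier A"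
    show "pp_sol A \<phi> x v \<longleftrightarrow> pp_sol B \<phi> x v"
      using lin_substructure[OF AB H v] lin_substructure[OF AB K x[unfolded pp_arity_def]]
      unfolding defs by simp
  next
    fix M x v x' v'
    assume M: "M \<in> RMod R" and x: "x \<in> {..<pp_arity \<phi>} \<rightarrow> carrier M"
      and v: "v \<in> {..<dim_col (fst \<phi>)} \<rightarrow> carrier M" and sol: "pp_sol M \<phi> x v"
    {
      assume "\<And>j. j < pp_arity \<phi> \<Longrightarrow> x j = x' j" "\<And>k. k \<in> {..<dim_col (fst \<phi>)} \<Longrightarrow> v k = v' k"
      then have "lin M (\<lambda>j. fst \<phi> $$ (i, j)) {..<dim_col (fst \<phi>)} v = lin M (\<lambda>j. fst \<phi> $$ (i, j)) {..<dim_col (fst \<phi>)} v'"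
        and "lin M (\<lambda>j. snd \<phi> $$ (i, j)) {..<dim_col (snd \<phi>)} x = lin M (\<lambda>j. snd \<phi> $$ (i, j)) {..<dim_col (snd \<phi>)} x'"
        if "i < dim_row (fst \<phi>)" for i
        using lin_cong[OF M H[OF that] v] lin_cong[OF M K[OF that]] x unfolding pp_arity_def by auto
      then show "pp_sol M \<phi> x' v'" using sol unfolding defs by simp
    next
      assume x': "x' \<in> {..<pp_arity \<phi>} \<rightarrow> carrier M"
        and v': "v' \<in> {..<dim_col (fst \<phi>)} \<rightarrow> carrier M" and sol': "pp_sol M \<phi> x' v'"
      show "pp_sol M \<phi> (\<lambda>j. x j \<oplus>\<^bsub>M\<^esub> x' j) (\<lambda>k. v k \<oplus>\<^bsub>M\<^esub> v' k)"
        using sol sol' lin_add[OF M H v v'] lin_add[OF M K x[unfolded pp_arity_def] x'[unfolded pp_arity_def]]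
        unfolding defs by simp
      show "pp_sol M \<phi> (\<lambda>j. x j \<ominus>\<^bsub>M\<^esub> x' j) (\<lambda>k. v k \<ominus>\<^bsub>M\<^esub> v' k)"
        using sol sol' lin_diff[OF M H v v'] lin_diff[OF M K x[unfolded pp_arity_def] x'[unfolded pp_arity_def]]
        unfolding defs by simp
    }
  }
qed

text \<open>
  A matrix is coded by its dimensions and the list of its entries, row after row.
\<close>

lemma card_mats:
  fixes K :: "'k set"
  assumes K: "infinite K" and Y: "|Y| \<le>o |K|"
  shows "|{H. elements_mat H \<subseteq> Y}| \<le>o |K|"
proof -
  let ?f = "\<lambda>(m, n, xs). mat m n (\<lambda>(i, j). xs ! (i * n + j))"
  let ?T = "(UNIV :: nat set) \<times> (UNIV :: nat set) \<times> lists Y"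
  have "{H. elements_mat H \<subseteq> Y} \<subseteq> ?f ` ?T"
  proof
    fix H assume "H \<in> {H. elements_mat H \<subseteq> Y}"
    then have H: "i < dim_row H \<Longrightarrow> j < dim_col H \<Longrightarrow> H $$ (i, j) \<in> Y" for i j
      using elements_matI[of H "dim_row H" "dim_col H" i j] by auto
    define m n where "m = dim_row H" and "n = dim_col H"
    define xs where "xs = map (\<lambda>t. H $$ (t div n, t mod n)) [0..<m * n]"
    have "xs \<in> lists Y"
    proof -
      have "t div n < m" "t mod n < n" if "t < m * n" for t
        using that by (auto simp: less_mult_imp_div_less) (metis mod_less_divisor mult_0_right not_gr_zero not_less_zero)
      then show ?thesis unfolding xs_def m_def n_def using H by auto
    qed
    moreover have "H = mat m n (\<lambda>(i, j). xs ! (i * n + j))"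
    proof (rule eq_matI)
      fix i j assume "i < dim_row (mat m n (\<lambda>(i, j). xs ! (i * n + j)))"
        "j < dim_col (mat m n (\<lambda>(i, j). xs ! (i * n + j)))"
      then have ij: "i < m" "j < n" by auto
      have "i * n + j < Suc i * n" using ij(2) by simp
      also have "\<dots> \<le> m * n" using ij(1) by (intro mult_right_mono) auto
      finally have "i * n + j < m * n" .
      then show "H $$ (i, j) = mat m n (\<lambda>(i, j). xs ! (i * n + j)) $$ (i, j)"
        unfolding xs_def using ij by simp
    qed (simp_all add: m_def n_def)
    ultimately show "H \<in> ?f ` ?T" by (intro image_eqI[of _ _ "(m, n, xs)"]) simp_all
  qed
  then have "|{H. elements_mat H \<subseteq> Y}| \<le>o |?T|"
    using surj_imp_ordLeq by blast
  also have "|?T| \<le>o |K|"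
  proof -
    have nat: "|UNIV :: nat set| \<le>o |K|" using K infinite_iff_card_of_nat by blast
    have "|lists Y| \<le>o |lists K|" using Y by (rule card_of_lists_mono)
    then have "|lists Y| \<le>o |K|" using card_of_lists_infinite[OF K] ordLeq_ordIso_trans by blast
    then show ?thesis using nat K by (intro card_of_Times_ordLeq_infinite)
  qed
  finally show ?thesis .
qed

lemma card_pleasant_set:
  fixes K :: "'k set"
  assumes "pleasant_set R S" and K: "infinite K" and RK: "|carrier R| \<le>o |K|"
  shows "|S| \<le>o |K|"
proof -
  let ?T = "{H. elements_mat H \<subseteq> carrier R}"
  have "S \<subseteq> ?T \<times> ?T" using assms(1) unfolding pleasant_set_def by auto
  then have "|S| \<le>o |?T \<times> ?T|" by (rule card_of_mono1)
  also have "|?T \<times> ?T| \<le>o |K|"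
    using card_mats[OF K RK] K by (intro card_of_Times_ordLeq_infinite)
  finally show ?thesis .
qed

text \<open>
  Here \<open>\<kappa> = |R| + \<aleph>\<^sub>0\<close>. The equation \<open>\<lambda>\<^sup>\<kappa> = \<lambda>\<close> also yields \<open>\<kappa> < 2\<^sup>\<kappa> \<le> \<lambda>\<close>, so \<open>\<lambda>\<close> is at least the
  Loewenheim-Skolem number.
\<close>

lemma pleasant_stable:
  fixes R :: "('r, 'm) ring_scheme" and prec :: "('r, 'u) module rel" and l :: "'u rel"
  assumes prec: "prec \<in> LL R" "pleasant R prec"
    and l: "small_cardinal l" "cinfinite l" "l ^c ( |carrier R| +c natLeq) =o l"
  shows "stable_in R (RMod R) prec l"
proof -
  obtain S where S: "pleasant_set R S" and prec_eq: "prec = le_formulas R pp_arity pp_sat S"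
    using prec(2) unfolding pleasant_def by blast
  interpret existential_linear_formulas R pp_arity "\<lambda>\<phi>. {..<dim_col (fst \<phi>)}" pp_sol pp_sat S
    using S by (rule pleasant_set_existential_linear)
  let ?K = "carrier R <+> (UNIV :: nat set)"
  have K_eq: "|carrier R| +c natLeq = |?K|" by (simp add: csum_def Field_card_of Field_natLeq)
  have K: "infinite ?K" by (simp add: finite_Plus_iff)
  have RK: "|carrier R| \<le>o |?K|" and SK: "|S| \<le>o |?K|"
    using card_of_Plus1 card_pleasant_set[OF S K] by blast+
  have ixK: "|{..<dim_col (fst \<phi>)}| \<le>o |?K|" for \<phi> :: "'r pp_form"
    using K ordLess_imp_ordLeq[OF finite_ordLess_infinite2] by blast
  have lC: "Cinfinite l" using l unfolding small_cardinal_def by blast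
  have "|?K| <o ctwo ^c |?K|" by (rule ordLess_ctwo_cexp) (rule card_of_Card_order)
  also have "ctwo ^c |?K| \<le>o l ^c |?K|"
    using ctwo_ordLeq_Cinfinite[OF lC] by (rule cexp_mono1) (rule card_of_Card_order)
  also have "l ^c |?K| =o l" using l(3) K_eq by simp
  finally have Kl: "|?K| \<le>o l" by (rule ordLess_imp_ordLeq)
  have LS: "LS_bound R (RMod R) prec l"
    unfolding prec_eq
    by (rule LS_bound_le_formulas[OF _ K RK SK ixK])
      (use prec l Kl K_eq in \<open>auto simp: LL_def prec_eq[symmetric]\<close>)
  show ?thesis
  proof (rule stable_inI[OF _ K RK l(1,2) _ LS])
    show "AEC R (RMod R) prec" using prec(1) unfolding LL_def by simp
    show "l ^c |?K| \<le>o l" using l(3) K_eq ordIso_imp_ordLeq by metis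
    show "l \<le>o l" using lC ordLeq_refl by blast
    show "\<exists>N. b \<in> N \<and> submodule_of R B N \<and> |N| \<le>o |?K| \<and>
        (restrict_module R B (sum_of_sets B N (carrier A)), B) \<in> prec"
      if "(A, B) \<in> prec" "b \<in> carrier B" for A B b
      using small_hull_point[OF _ that(2) K RK SK ixK] that(1) unfolding prec_eq by blast
  qed
qed


section \<open>Cardinals below an inaccessible\<close>

lemma small_set_representative:
  assumes "|Y| <o |UNIV :: 'u set|"
  obtains T :: "'u set" where "|T| =o |Y|"
proof -
  obtain f :: "_ \<Rightarrow> 'u" where "inj_on f Y"
    using ordLess_imp_ordLeq[OF assms] card_of_ordLeq[of Y "UNIV :: 'u set"] by blast
  then have "bij_betw f Y (f ` Y)" by (rule inj_on_imp_bij_betw)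
  then show ?thesis using that card_of_ordIsoI ordIso_symmetric by blast
qed

lemma infinite_inaccessible: "inaccessible |UNIV :: 'u set| \<Longrightarrow> infinite (UNIV :: 'u set)"
  unfolding inaccessible_def
  by (metis Field_card_of Field_natLeq card_of_mono2 card_of_ordLeq_infinite infinite_UNIV_nat ordLess_imp_ordLeq)

lemma small_nat: "inaccessible |UNIV :: 'u set| \<Longrightarrow> |UNIV :: nat set| <o |UNIV :: 'u set|"
  unfolding inaccessible_def using card_of_nat ordIso_ordLess_trans by blast

lemma small_Pow:
  assumes inacc: "inaccessible |UNIV :: 'u set|" and Y: "|Y| <o |UNIV :: 'u set|"
  shows "|Pow Y| <o |UNIV :: 'u set|"
proof -
  obtain T :: "'u set" where T: "|T| =o |Y|" using small_set_representative[OF Y] .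
  have "|Pow Y| \<le>o |Pow T|"
    using T by (intro card_of_Pow_mono) (rule ordIso_imp_ordLeq[OF ordIso_symmetric])
  also have "|Pow T| =o ctwo ^c |T|"
    using card_of_Pow_Func unfolding ctwo_def cexp_def Field_card_of .
  also have "ctwo ^c |T| <o |UNIV :: 'u set|"
    using inacc ordIso_ordLess_trans[OF T Y] card_of_Card_order unfolding inaccessible_def by blast
  finally show ?thesis .
qed

text \<open>
  Let \<open>\<kappa> = |K|\<close> and \<open>\<theta> = \<kappa> + l0\<close>. The cardinal \<open>l = 2\<^sup>\<theta>\<close> works because \<open>\<theta>\<kappa> = \<theta>\<close>.
\<close>

lemma ex_cardinal_power_le:
  fixes l0 :: "'u rel" and K :: "'k set"
  assumes inacc: "inaccessible |UNIV :: 'u set|" and K: "infinite K" "|K| <o |UNIV :: 'u set|"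
    and l0: "small_cardinal l0"
  obtains l :: "'u rel" where "small_cardinal l" "cinfinite l" "l0 \<le>o l" "l ^c |K| \<le>o l"
proof -
  have U: "infinite (UNIV :: 'u set)" using inacc by (rule infinite_inaccessible)
  let ?Y = "K <+> Field l0"
  have l0_F: "l0 =o |Field l0|" and F: "|Field l0| <o |UNIV :: 'u set|"
    using l0 card_of_Field_ordIso ordIso_symmetric ordIso_ordLess_trans unfolding small_cardinal_def by blast+
  have "|?Y| <o |UNIV :: 'u set|" using card_of_Plus_ordLess_infinite[OF U K(2) F] .
  then have "|Pow ?Y| <o |UNIV :: 'u set|" by (rule small_Pow[OF inacc])
  then obtain T :: "'u set" where T: "|T| =o |Pow ?Y|" and small: "|T| <o |UNIV :: 'u set|"
    using small_set_representative ordIso_ordLess_trans by metis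
  have Y: "Cinfinite |?Y|" using K(1) by (simp add: cinfinite_def Field_card_of card_of_Card_order finite_Plus_iff)
  have T2: "|T| =o ctwo ^c |?Y|"
    using ordIso_transitive[OF T card_of_Pow_Func] unfolding ctwo_def cexp_def Field_card_of .
  have YT: "|?Y| \<le>o |T|"
    using ordLess_ordIso_trans[OF card_of_Pow ordIso_symmetric[OF T]] by (rule ordLess_imp_ordLeq)
  show ?thesis
  proof
    show "small_cardinal |T|" unfolding small_cardinal_def using small card_of_Card_order by blast
    show "cinfinite |T|" using cinfinite_mono[OF YT] Y by blast
    have "l0 \<le>o |?Y|" using ordIso_ordLeq_trans[OF l0_F card_of_Plus2] .
    then show "l0 \<le>o |T|" using YT by (rule ordLeq_transitive)
    have "|T| ^c |K| =o (ctwo ^c |?Y| ) ^c |K|" using T2 by (rule cexp_cong1) (rule card_of_Card_order)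
    also have "(ctwo ^c |?Y| ) ^c |K| =o ctwo ^c |?Y|"
    proof (rule cexp_cprod_ordLeq[OF Card_order_ctwo Y])
      have "K \<noteq> {}" using K(1) by auto
      then show "Cnotzero |K|" by (simp add: card_of_ordIso_czero_iff_empty card_of_Card_order)
      show "|K| \<le>o |?Y|" by (rule card_of_Plus1)
    qed
    also have "ctwo ^c |?Y| =o |T|" using T2 by (rule ordIso_symmetric)
    finally show "|T| ^c |K| \<le>o |T|" by (rule ordIso_imp_ordLeq)
  qed
qed


section \<open>Infinitary formulas with finitely many free variables\<close>

definition E_supp :: "('r, 'm) ring_scheme \<Rightarrow> 'u rel \<Rightarrow> ('u \<Rightarrow> 'u \<Rightarrow> 'r) \<Rightarrow> 'u \<Rightarrow> 'u set" where
  "E_supp R l r i = {k\<in>Field l. r i k \<noteq> \<zero>\<^bsub>R\<^esub>}"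

definition E_sol ::
    "('r, 'm) ring_scheme \<Rightarrow> 'u rel \<Rightarrow> ('r, 'u) module \<Rightarrow> ('r, 'u) E_form \<Rightarrow> (nat \<Rightarrow> 'u) \<Rightarrow>
     ('u \<Rightarrow> 'u) \<Rightarrow> bool" where
  "E_sol R l M = (\<lambda>(n, r, q) x v.
     \<forall>i\<in>Field l. lin M (r i) (E_supp R l r i) v \<oplus>\<^bsub>M\<^esub> lin M (q i) {..<n} x = \<zero>\<^bsub>M\<^esub>)"

lemma E_sat_iff: "E_sat R l M \<phi> x \<longleftrightarrow> (\<exists>v \<in> Field l \<rightarrow> carrier M. E_sol R l M \<phi> x v)"
  by (cases \<phi>) (simp add: E_sat_def E_sol_def lin_def E_supp_def)

lemma E_form_existential_linear:
  assumes wf: "\<And>\<phi>. \<phi> \<in> S \<Longrightarrow> E_form_wf R l \<phi>"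
  shows "existential_linear_formulas R fst (\<lambda>_. Field l) (E_sol R l) (E_sat R l) S"
proof
  fix \<phi> :: "('b, 'a) E_form" assume \<phi>: "\<phi> \<in> S"
  obtain n r q where \<phi>_eq: "\<phi> = (n, r, q)" by (cases \<phi>)
  have r: "r i \<in> E_supp R l r i \<rightarrow> carrier R" and fin: "finite (E_supp R l r i)"
    and q: "q i \<in> {..<n} \<rightarrow> carrier R" if "i \<in> Field l" for i
    using wf[OF \<phi>] that unfolding E_form_wf_def E_supp_def \<phi>_eq by auto
  {
    fix M :: "('b, 'a) module" and x
    show "E_sat R l M \<phi> x \<longleftrightarrow> (\<exists>v \<in> Field l \<rightarrow> carrier M. E_sol R l M \<phi> x v)"
      by (rule E_sat_iff)
  next
    fix A B :: "('b, 'a) module" and x v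
    assume A: "A \<in> RMod R" and B: "B \<in> RMod R" and sub: "substructure R A B"
      and x: "x \<in> {..<fst \<phi>} \<rightarrow> carrier A" and v: "v \<in> Field l \<rightarrow> carrier A"
    have x': "x \<in> {..<n} \<rightarrow> carrier A" using x \<phi>_eq by simp
    have v': "v \<in> E_supp R l r i \<rightarrow> carrier A" for i using v unfolding E_supp_def by auto
    have "lin A (r i) (E_supp R l r i) v \<oplus>\<^bsub>A\<^esub> lin A (q i) {..<n} x
        = lin B (r i) (E_supp R l r i) v \<oplus>\<^bsub>B\<^esub> lin B (q i) {..<n} x" if i: "i \<in> Field l" for i
      using substructure_simps(3)[OF sub lin_closed[OF A r[OF i] v'] lin_closed[OF A q[OF i] x']]
        lin_substructure[OF A B sub r[OF i] v' fin[OF i]] lin_substructure[OF A B sub q[OF i] x'] by simp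
    then show "E_sol R l A \<phi> x v \<longleftrightarrow> E_sol R l B \<phi> x v"
      unfolding E_sol_def \<phi>_eq using substructure_simps(2)[OF sub] by simp
  next
    fix M :: "('b, 'a) module" and x v x' v'
    assume M: "M \<in> RMod R" and x: "x \<in> {..<fst \<phi>} \<rightarrow> carrier M"
      and v: "v \<in> Field l \<rightarrow> carrier M" and sol: "E_sol R l M \<phi> x v"
    interpret M: abelian_group M using M by (rule RMod_abelian_group)
    have xn: "x \<in> {..<n} \<rightarrow> carrier M" using x \<phi>_eq by simp
    have vs: "v \<in> E_supp R l r i \<rightarrow> carrier M" for i using v unfolding E_supp_def by auto
    have sol_eq: "lin M (r i) (E_supp R l r i) v \<oplus>\<^bsub>M\<^esub> lin M (q i) {..<n} x = \<zero>\<^bsub>M\<^esub>" if "i \<in> Field l" for i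
      using sol that unfolding E_sol_def \<phi>_eq by simp
    {
      assume xx: "\<And>j. j < fst \<phi> \<Longrightarrow> x j = x' j" and vv: "\<And>k. k \<in> Field l \<Longrightarrow> v k = v' k"
      have "lin M (r i) (E_supp R l r i) v = lin M (r i) (E_supp R l r i) v'"
        and "lin M (q i) {..<n} x = lin M (q i) {..<n} x'" if i: "i \<in> Field l" for i
        using lin_cong[OF M r[OF i] vs, of v'] lin_cong[OF M q[OF i] xn, of x'] xx vv
        unfolding \<phi>_eq E_supp_def by auto
      then show "E_sol R l M \<phi> x' v'" using sol unfolding E_sol_def \<phi>_eq by simp
    next
      assume x': "x' \<in> {..<fst \<phi>} \<rightarrow> carrier M"
        and v': "v' \<in> Field l \<rightarrow> carrier M" and sol': "E_sol R l M \<phi> x' v'"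
      have xn': "x' \<in> {..<n} \<rightarrow> carrier M" using x' \<phi>_eq by simp
      have vs': "v' \<in> E_supp R l r i \<rightarrow> carrier M" for i using v' unfolding E_supp_def by auto
      have sol_eq': "lin M (r i) (E_supp R l r i) v' \<oplus>\<^bsub>M\<^esub> lin M (q i) {..<n} x' = \<zero>\<^bsub>M\<^esub>"
        if "i \<in> Field l" for i
        using sol' that unfolding E_sol_def \<phi>_eq by simp
      have closed: "lin M (r i) (E_supp R l r i) v \<in> carrier M" "lin M (q i) {..<n} x \<in> carrier M"
        "lin M (r i) (E_supp R l r i) v' \<in> carrier M" "lin M (q i) {..<n} x' \<in> carrier M"
        if "i \<in> Field l" for i
        using lin_closed[OF M r[OF that] vs] lin_closed[OF M q[OF that] xn]
          lin_closed[OF M r[OF that] vs'] lin_closed[OF M q[OF that] xn'] by auto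
      have "lin M (r i) (E_supp R l r i) (\<lambda>k. v k \<oplus>\<^bsub>M\<^esub> v' k) \<oplus>\<^bsub>M\<^esub> lin M (q i) {..<n} (\<lambda>j. x j \<oplus>\<^bsub>M\<^esub> x' j)
        = (lin M (r i) (E_supp R l r i) v \<oplus>\<^bsub>M\<^esub> lin M (q i) {..<n} x)
          \<oplus>\<^bsub>M\<^esub> (lin M (r i) (E_supp R l r i) v' \<oplus>\<^bsub>M\<^esub> lin M (q i) {..<n} x')" if i: "i \<in> Field l" for i
        using closed[OF i] by (simp add: lin_add[OF M r[OF i] vs vs'] lin_add[OF M q[OF i] xn xn'] M.a_ac)
      then show "E_sol R l M \<phi> (\<lambda>j. x j \<oplus>\<^bsub>M\<^esub> x' j) (\<lambda>k. v k \<oplus>\<^bsub>M\<^esub> v' k)"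
        unfolding E_sol_def \<phi>_eq using sol_eq sol_eq' by simp
      have "lin M (r i) (E_supp R l r i) (\<lambda>k. v k \<ominus>\<^bsub>M\<^esub> v' k) \<oplus>\<^bsub>M\<^esub> lin M (q i) {..<n} (\<lambda>j. x j \<ominus>\<^bsub>M\<^esub> x' j)
        = (lin M (r i) (E_supp R l r i) v \<oplus>\<^bsub>M\<^esub> lin M (q i) {..<n} x)
          \<ominus>\<^bsub>M\<^esub> (lin M (r i) (E_supp R l r i) v' \<oplus>\<^bsub>M\<^esub> lin M (q i) {..<n} x')" if i: "i \<in> Field l" for i
        using closed[OF i] M.add_diff_add
        by (simp add: lin_diff[OF M r[OF i] vs vs'] lin_diff[OF M q[OF i] xn xn'])
      then show "E_sol R l M \<phi> (\<lambda>j. x j \<ominus>\<^bsub>M\<^esub> x' j) (\<lambda>k. v k \<ominus>\<^bsub>M\<^esub> v' k)"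
        unfolding E_sol_def \<phi>_eq using sol_eq sol_eq' by (simp add: M.diff_eq_zero_iff)
    }
  }
qed

text \<open>
  The coefficient functions of a formula take values outside \<open>Field l\<close> too, so a set of formulas
  may be as large as its type even though few of its members differ in meaning. The graph keeps
  exactly the coefficients that occur in the formula.
\<close>

definition E_form_graph ::
    "'u rel \<Rightarrow> ('r, 'u) E_form \<Rightarrow> nat \<times> ('u \<times> 'u \<times> 'r) set \<times> ('u \<times> nat \<times> 'r) set" where
  "E_form_graph l = (\<lambda>(n, r, q).
     (n, {(i, k, r i k) | i k. i \<in> Field l \<and> k \<in> Field l}, {(i, j, q i j) | i j. i \<in> Field l \<and> j < n}))"

lemma E_sat_cong_graph:
  assumes wf: "E_form_wf R l \<phi>" and eq: "E_form_graph l \<phi> = E_form_graph l \<psi>"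
    and M: "M \<in> RMod R" and x: "x \<in> {..<fst \<phi>} \<rightarrow> carrier M"
  shows "E_sat R l M \<phi> x \<longleftrightarrow> E_sat R l M \<psi> x"
proof -
  obtain n r q where \<phi>: "\<phi> = (n, r, q)" by (cases \<phi>)
  obtain n' r' q' where \<psi>: "\<psi> = (n', r', q')" by (cases \<psi>)
  have n: "n' = n"
    and R_eq: "{(i, k, r i k) | i k. i \<in> Field l \<and> k \<in> Field l} = {(i, k, r' i k) | i k. i \<in> Field l \<and> k \<in> Field l}"
    and Q_eq: "{(i, j, q i j) | i j. i \<in> Field l \<and> j < n} = {(i, j, q' i j) | i j. i \<in> Field l \<and> j < n}"
    using eq unfolding \<phi> \<psi> E_form_graph_def by auto
  have r: "r i k = r' i k" if "i \<in> Field l" "k \<in> Field l" for i k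
    using R_eq that by blast
  have q: "q i j = q' i j" if "i \<in> Field l" "j < n" for i j
    using Q_eq that by blast
  have supp: "E_supp R l r i = E_supp R l r' i" if "i \<in> Field l" for i
    unfolding E_supp_def using r[OF that] by auto
  interpret M: abelian_group M using M by (rule RMod_abelian_group)
  have "lin M (r i) (E_supp R l r i) v = lin M (r' i) (E_supp R l r' i) v"
    if i: "i \<in> Field l" and v: "v \<in> Field l \<rightarrow> carrier M" for i v
    unfolding lin_def supp[OF i]
  proof (rule M.finsum_cong'[OF refl])
    show "(\<lambda>k. r' i k \<odot>\<^bsub>M\<^esub> v k) \<in> E_supp R l r' i \<rightarrow> carrier M"
      using i v r wf RMod_smult_closed[OF M] unfolding E_supp_def E_form_wf_def \<phi> by (auto simp: Pi_iff)
    show "r i k \<odot>\<^bsub>M\<^esub> v k = r' i k \<odot>\<^bsub>M\<^esub> v k" if "k \<in> E_supp R l r' i" for k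
      using that r[OF i] unfolding E_supp_def by simp
  qed
  moreover have "lin M (q i) {..<n} x = lin M (q' i) {..<n} x" if i: "i \<in> Field l" for i
    unfolding lin_def
  proof (rule M.finsum_cong'[OF refl])
    show "(\<lambda>j. q' i j \<odot>\<^bsub>M\<^esub> x j) \<in> {..<n} \<rightarrow> carrier M"
      using i x q wf RMod_smult_closed[OF M] unfolding E_form_wf_def \<phi> by (auto simp: Pi_iff)
    show "q i j \<odot>\<^bsub>M\<^esub> x j = q' i j \<odot>\<^bsub>M\<^esub> x j" if "j \<in> {..<n}" for j
      using that q[OF i] by simp
  qed
  ultimately have "E_sol R l M \<phi> x v \<longleftrightarrow> E_sol R l M \<psi> x v" if "v \<in> Field l \<rightarrow> carrier M" for v
    unfolding E_sol_def \<phi> \<psi> n using that by simp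
  then show ?thesis unfolding E_sat_iff by blast
qed

text \<open>
  One formula is kept for each graph, and there is only a small set of graphs: a cardinal that bounds
  the number of formulas can then be found below the inaccessible one.
\<close>

lemma E_form_representatives:
  fixes l :: "'u rel" and R :: "('r, 'm) ring_scheme"
  assumes inacc: "inaccessible |UNIV :: 'u set|" and R: "|carrier R| <o |UNIV :: 'u set|"
    and l: "small_cardinal l" and wf: "\<forall>\<phi>\<in>S. E_form_wf R l \<phi>"
  obtains S' where "S' \<subseteq> S" "|S'| <o |UNIV :: 'u set|"
    "le_formulas R fst (E_sat R l) S = le_formulas R fst (E_sat R l) S'"
proof -
  have U: "infinite (UNIV :: 'u set)" using inacc by (rule infinite_inaccessible)
  have nat: "|UNIV :: nat set| <o |UNIV :: 'u set|" using inacc by (rule small_nat)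
  have F: "|Field l| <o |UNIV :: 'u set|"
    using l card_of_Field_ordIso ordIso_ordLess_trans unfolding small_cardinal_def by blast
  let ?T = "(UNIV :: nat set) \<times> Pow (Field l \<times> Field l \<times> carrier R) \<times> Pow (Field l \<times> (UNIV :: nat set) \<times> carrier R)"
  have T: "|?T| <o |UNIV :: 'u set|"
    by (intro card_of_Times_ordLess_infinite[OF U] small_Pow[OF inacc] nat F R)
  obtain S' where S': "S' \<subseteq> S" "inj_on (E_form_graph l) S'" "E_form_graph l ` S = E_form_graph l ` S'"
    using subset_image_inj[of "E_form_graph l ` S" "E_form_graph l" S] by auto
  have "E_form_graph l ` S' \<subseteq> ?T"
  proof
    fix t assume "t \<in> E_form_graph l ` S'"
    then obtain n r q where \<phi>: "(n, r, q) \<in> S" "t = E_form_graph l (n, r, q)" using S'(1) by auto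
    then have "E_form_wf R l (n, r, q)" using wf by blast
    then show "t \<in> ?T" unfolding \<phi>(2) E_form_graph_def E_form_wf_def by auto
  qed
  then have "|S'| \<le>o |?T|" using S'(2) card_of_ordLeq by blast
  then have small: "|S'| <o |UNIV :: 'u set|" using T by (rule ordLeq_ordLess_trans)
  have "(A, B) \<in> le_formulas R fst (E_sat R l) S" if AB: "(A, B) \<in> le_formulas R fst (E_sat R l) S'" for A B
  proof -
    have A: "A \<in> RMod R" and B: "B \<in> RMod R" and sub: "substructure R A B"
      using AB unfolding le_formulas_def by auto
    have "E_sat R l A \<phi> a \<longleftrightarrow> E_sat R l B \<phi> a" if \<phi>: "\<phi> \<in> S" and a: "a \<in> {..<fst \<phi>} \<rightarrow> carrier A" for \<phi> a
    proof -
      obtain \<psi> where \<psi>: "\<psi> \<in> S'" "E_form_graph l \<phi> = E_form_graph l \<psi>" using S'(3) \<phi> by blast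
      have "fst \<psi> = fst \<phi>" using \<psi>(2) unfolding E_form_graph_def by (auto simp: case_prod_unfold)
      then have "E_sat R l A \<psi> a \<longleftrightarrow> E_sat R l B \<psi> a" using AB \<psi>(1) a unfolding le_formulas_def by auto
      moreover have "a \<in> {..<fst \<phi>} \<rightarrow> carrier B" using a sub unfolding substructure_def by auto
      ultimately show ?thesis
        using E_sat_cong_graph[OF _ \<psi>(2) A a] E_sat_cong_graph[OF _ \<psi>(2) B] wf \<phi> by blast
    qed
    then show ?thesis unfolding le_formulas_def using A B sub by simp
  qed
  then have "le_formulas R fst (E_sat R l) S' \<subseteq> le_formulas R fst (E_sat R l) S" by (rule subrelI)
  moreover have "le_formulas R fst (E_sat R l) S \<subseteq> le_formulas R fst (E_sat R l) S'"
    unfolding le_formulas_def using S'(1) by blast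
  ultimately show ?thesis by (intro that[OF S'(1) small] equalityI)
qed

text \<open>
  Here \<open>\<kappa>\<close> bounds the number of formulas up to equivalence and the number of quantified variables.
  The required cardinal is chosen above the given \<open>l1\<close> and the Loewenheim-Skolem bound that the
  axioms provide.
\<close>

lemma E_nice_stable:
  fixes R :: "('r, 'm) ring_scheme" and prec :: "('r, 'u) module rel"
  assumes inacc: "inaccessible |UNIV :: 'u set|" and R: "|carrier R| <o |UNIV :: 'u set|"
    and prec: "prec \<in> LL R" "E_nice R prec"
  shows "stable_class R (RMod R) prec"
  unfolding stable_class_def
proof (intro allI impI)
  fix l1 :: "'u rel" assume l1: "small_cardinal l1"
  obtain l S0 where l: "small_cardinal l" "cinfinite l" "|carrier R| \<le>o l"
    and wf: "\<forall>\<phi>\<in>S0. E_form_wf R l \<phi>" and prec0: "prec = le_formulas R fst (E_sat R l) S0"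
    using prec(2) unfolding E_nice_def by blast
  obtain S where S: "S \<subseteq> S0" "|S| <o |UNIV :: 'u set|" and prec_eq: "prec = le_formulas R fst (E_sat R l) S"
    using E_form_representatives[OF inacc R l(1) wf] prec0 by metis
  interpret existential_linear_formulas R fst "\<lambda>_. Field l" "E_sol R l" "E_sat R l" S
    using wf S(1) by (intro E_form_existential_linear) blast
  have aec: "AEC R (RMod R) prec" using prec(1) unfolding LL_def by simp
  then obtain l2 where l2: "LS_bound R (RMod R) prec l2" unfolding AEC_def by blast
  have U: "infinite (UNIV :: 'u set)" using inacc by (rule infinite_inaccessible)
  let ?K = "S <+> Field l"
  have F: "|Field l| =o l" "|Field l| <o |UNIV :: 'u set|"
    using l(1) card_of_Field_ordIso ordIso_ordLess_trans unfolding small_cardinal_def by blast+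
  have K: "infinite ?K" using l(2) unfolding cinfinite_def by (simp add: finite_Plus_iff)
  have K_small: "|?K| <o |UNIV :: 'u set|" using card_of_Plus_ordLess_infinite[OF U S(2) F(2)] .
  have ixK: "|Field l| \<le>o |?K|" and SK: "|S| \<le>o |?K|" by (rule card_of_Plus2, rule card_of_Plus1)
  have RK: "|carrier R| \<le>o |?K|"
    using ordLeq_transitive[OF ordLeq_ordIso_trans[OF l(3) ordIso_symmetric[OF F(1)]] ixK] .
  have l2': "small_cardinal l2" using l2 unfolding LS_bound_def by blast
  obtain l3 :: "'u rel" where l3: "small_cardinal l3" "l1 \<le>o l3" "l2 \<le>o l3"
  proof -
    have W: "Card_order l1" "Card_order l2" using l1 l2' unfolding small_cardinal_def by auto
    then have "l1 \<le>o l2 \<or> l2 \<le>o l1"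
      using card_order_on_well_order_on ordLeq_total by blast
    then show ?thesis using that l1 l2' W ordLeq_refl by blast
  qed
  obtain l' :: "'u rel" where l': "small_cardinal l'" "cinfinite l'" "l3 \<le>o l'" "l' ^c |?K| \<le>o l'"
    by (rule ex_cardinal_power_le[OF inacc K K_small l3(1)])
  have "stable_in R (RMod R) prec l'"
  proof (rule stable_inI[OF aec K RK l'(1,2,4) l2])
    show "l2 \<le>o l'" using l3(3) l'(3) by (rule ordLeq_transitive)
    show "\<exists>N. b \<in> N \<and> submodule_of R B N \<and> |N| \<le>o |?K| \<and>
        (restrict_module R B (sum_of_sets B N (carrier A)), B) \<in> prec"
      if "(A, B) \<in> prec" "b \<in> carrier B" for A B b
      using small_hull_point[OF _ that(2) K RK SK ixK] that(1) unfolding prec_eq by blast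
  qed
  then show "\<exists>l'. l1 \<le>o l' \<and> stable_in R (RMod R) prec l'"
    using ordLeq_transitive[OF l3(2) l'(3)] by blast
qed

theorem theorem1p1:
  fixes R :: "('r, 'm) ring_scheme" and prec :: "('r, 'u) module rel"
  assumes "inaccessible |UNIV :: 'u set|"
    and "ring R" and "|carrier R| <o |UNIV :: 'u set|"
  shows "(prec \<in> LL1 R \<and> pleasant R prec \<longrightarrow>
            (\<forall>l :: 'u rel. small_cardinal l \<and> cinfinite l \<and> l ^c ( |carrier R| +c natLeq) =o l \<longrightarrow>
               stable_in R (RMod R) prec l)) \<and>
         (prec \<in> LL2 R \<and> E_nice R prec \<longrightarrow> stable_class R (RMod R) prec)"
  using pleasant_stable[of prec R] E_nice_stable[OF assms(1,3)] unfolding LL1_def LL2_def by blast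

end
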